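(* Let $f(x,y)=0$ be a reduced curve germ, with $f(0,0)=0$ and $f(0,y)\not\equiv0$. Fix $B\in T(f)$. Let $N$ be the index of $\lambda_B$. Write $h(B)=\frac{m}{nN}$ and $q(B)=\frac{L}{M}$ where $m,n,L,M$ are positive integers with $\gcd(m,n)=\gcd(L,M)=1$. Let $H_B(t)$ be the unique polynomial with $H_B(z^n)=F_B(z)^M$, and let $H_B'(t)=C(t-t_1)\cdots(t-t_r)$. Set $\mathsf w_0=H_B(0)$, $\mathsf w_j=H_B(t_j)$ for $1\le j\le r$, and $J=\{j\in\{1,\dots,r\}:\mathsf w_j\ne0\}$. Then $$\mathrm{in}_{\mathcal N}\,\mathcal D_{\overline B}(u,v)=(v^M-\mathsf w_0u^L)^{(n-1)N/M}\prod_{j\in J}(v^M-\mathsf w_ju^L)^{nN/M}\quad\text{if }\mathsf w_0\neq0,$$ $$\mathrm{in}_{\mathcal N}\,\mathcal D_{\overline B}(u,v)=\prod_{j\in J}(v^M-\mathsf w_ju^L)^{nN/M}\quad\text{if }\mathsf w_0=0.$$ Moreover these formulas give a polynomial factorization of $\mathrm{in}_{\mathcal N}\,\mathcal D_{\overline B}(u,v)$, i.e. the powers occurring as factors on the right-hand sides are polynomials (the exponents of the factors that occur are nonnegative integers).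
   Context: Puiseux series: $\mathbf C\{x\}^*$ is the ring of convergent Puiseux series in $x$ with nonnegative exponents; a fractional power series is one of positive order. For $\alpha,\gamma\in\mathbf C\{x\}^*$, $O(\alpha,\gamma)=\mathrm{ord}(\alpha(x)-\gamma(x))$. $\mathrm{Zer}\, g$ is the set of Newton–Puiseux roots of $g$, i.e. fractional power series $\gamma$ with $g(x,\gamma(x))=0$. The index of a fractional power series $\beta$ is the smallest positive integer $N$ with $\beta\in\mathbf C\{x^{1/N}\}$. "$+\cdots$" means plus higher order terms. Write $f=u\prod_{i=1}^p[y-\alpha_i(x)]$, $\frac{\partial f}{\partial y}=\tilde u\prod_{j=1}^{p-1}[y-\gamma_j(x)]$ with $u,\tilde u$ units and $\alpha_i,\gamma_j$ fractional power series (the $\alpha_i$ are distinct, the $\gamma_j$ are listed with multiplicity). Tree model: for $\alpha\in\mathbf C\{x\}^*$ and rational $h>0$, the pseudo-ball is $B(\alpha,h)=\{\gamma\in\mathbf C\{x\}^*: O(\gamma,\alpha)\ge h\}$, of height $h(B)=h$. $T(f)=\{B(\alpha,O(\alpha,\alpha')):\alpha,\alpha'\in\mathrm{Zer} f,\ \alpha\ne\alpha'\}$. For $B\in T(f)$, $\lambda_B(x)$ is obtained from any $\alpha\in B$ by omitting all terms of order $\ge h(B)$. There are a polynomial $F_B(z)\in\mathbf C[z]$ (nonzero) and a rational number $q(B)$, determined by $f$ and $B$, such that for every $\gamma(x)=\lambda_B(x)+cx^{h(B)}+\cdots$ one has $f(x,\gamma(x))=F_B(c)x^{q(B)}+\cdots$.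 A root $\gamma_j$ leaves $T(f)$ at $B\in T(f)$ if $\gamma_j\in B$ and $h(B)=\max_i O(\alpha_i,\gamma_j)$. Conjugation: choose a positive integer $D$ such that all $\alpha_i,\gamma_j\in\mathbf C\{x^{1/D}\}$, and let $\mathbf U_D=\{\theta\in\mathbf C:\theta^D=1\}$ act by $\theta*\sum a_kx^{N_k/D}=\sum a_k\theta^{N_k}x^{N_k/D}$. It acts on $T(f)$ by $\theta*B(\alpha,h)=B(\theta*\alpha,h)$ ($\alpha\in\mathrm{Zer} f$); $\overline B$ denotes the orbit of $B$. Put $\mathcal D_B(u,v)=\prod_j(v-f(u,\gamma_j(u)))$, the product over all $j$ such that $\gamma_j$ leaves $T(f)$ at $B$, and $\mathcal D_{\overline B}=\prod_{B'\in\overline B}\mathcal D_{B'}$, which lies in $\mathbf C\{u\}[v]$. The polynomial $H_B$ with $H_B(z^n)=F_B(z)^M$ exists and is unique. For $g=\sum a_{ij}u^iv^j\neq 0$, the Newton diagram is the convex hull of $\{(i,j):a_{ij}\neq0\}+\mathbf R_{\ge0}^2$, and $\mathrm{in}_{\mathcal N}g$ is the sum of the terms $a_{ij}u^iv^j$ with $(i,j)$ on a compact edge of it. *)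

theory Defs
  imports
    "HOL-Analysis.Analysis"
    "HOL-Computational_Algebra.Computational_Algebra"
    "HOL-Library.Extended"
begin

section \<open>Power series in two variables\<close>

text \<open>A series in \<open>x, y\<close> (or \<open>u, v\<close>) is a power series in the second variable whose
  coefficients are power series in the first one. Thus the second variable is \<^term>\<open>fps_X\<close>,
  the first one is \<^term>\<open>fps_const fps_X\<close>, and \<open>\<partial>/\<partial>y\<close> is \<^const>\<open>fps_deriv\<close>.\<close>

type_synonym bseries = "complex fps fps"

text \<open>The coefficient of \<open>x^i y^j\<close>.\<close>
definition bcoeff :: "bseries \<Rightarrow> nat \<Rightarrow> nat \<Rightarrow> complex" where
  "bcoeff f i j = fps_nth (fps_nth f j) i"

definition bconvergent :: "bseries \<Rightarrow> bool" where
  "bconvergent f \<longleftrightarrow> (\<exists>r>0. (\<lambda>(i, j). norm (bcoeff f i j) * r ^ (i + j)) summable_on UNIV)"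

definition bunit :: "bseries \<Rightarrow> bool" where
  "bunit u \<longleftrightarrow> bconvergent u \<and> (\<exists>w. bconvergent w \<and> u * w = 1)"

text \<open>Reducedness: no multiple factors in \<open>\<complex>{x,y}\<close>. The zero series is excluded by this.\<close>
definition breduced :: "bseries \<Rightarrow> bool" where
  "breduced f \<longleftrightarrow> (\<forall>g k. bconvergent g \<longrightarrow> bconvergent k \<longrightarrow> f = g ^ 2 * k \<longrightarrow> bunit g)"

text \<open>The series \<open>f(s^D, y)\<close> in the variables \<open>s, y\<close>.\<close>
definition ramify :: "nat \<Rightarrow> bseries \<Rightarrow> bseries" where
  "ramify D f = Abs_fps (\<lambda>j. fps_compose (fps_nth f j) (fps_X ^ D))"

text \<open>The series \<open>f(s, g(s))\<close>, for \<open>g(0) = 0\<close>: then \<open>g^j\<close> has order at least \<open>j\<close>, so only the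
  terms with \<open>j \<le> k\<close> contribute to the coefficient of \<open>s^k\<close>.\<close>
definition subst_snd :: "bseries \<Rightarrow> complex fps \<Rightarrow> complex fps" where
  "subst_snd f g = Abs_fps (\<lambda>k. \<Sum>j\<le>k. fps_nth (fps_nth f j * g ^ j) k)"

section \<open>Puiseux series\<close>

text \<open>A Puiseux series is given by its coefficients: \<open>\<alpha> q\<close> is the coefficient of \<open>x^q\<close>.\<close>

type_synonym puiseux = "rat \<Rightarrow> complex"

text \<open>The series \<open>\<alpha>(s^D)\<close> in \<open>s = x^{1/D}\<close>, for \<open>\<alpha>\<close> a series in \<open>x^{1/D}\<close>, and conversely
  the series \<open>a(x^{1/D})\<close>.\<close>
definition to_root :: "nat \<Rightarrow> puiseux \<Rightarrow> complex fps" where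
  "to_root D \<alpha> = Abs_fps (\<lambda>k. \<alpha> (of_nat k / of_nat D))"

definition of_root :: "nat \<Rightarrow> complex fps \<Rightarrow> puiseux" where
  "of_root D a = (\<lambda>q. if q \<ge> 0 \<and> q * of_nat D \<in> \<int> then fps_nth a (nat \<lfloor>q * of_nat D\<rfloor>) else 0)"

text \<open>\<open>\<complex>{x^{1/D}}\<close> (for \<open>D > 0\<close>) and \<open>\<complex>{x}\<^sup>*\<close>.\<close>
definition root_series :: "nat \<Rightarrow> puiseux set" where
  "root_series D = {\<alpha>. (\<forall>q. \<alpha> q \<noteq> 0 \<longrightarrow> q \<ge> 0 \<and> q * of_nat D \<in> \<int>) \<and>
                       fps_conv_radius (to_root D \<alpha>) > 0}"

definition puiseux_series :: "puiseux set" where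
  "puiseux_series = (\<Union>D\<in>{0<..}. root_series D)"

definition puiseux_index :: "puiseux \<Rightarrow> nat" where
  "puiseux_index \<alpha> = (LEAST N. N > 0 \<and> \<alpha> \<in> root_series N)"

definition puiseux_ord :: "puiseux \<Rightarrow> rat extended" where
  "puiseux_ord \<alpha> = (if \<alpha> = (\<lambda>_. 0) then Pinf else Fin (LEAST q. \<alpha> q \<noteq> 0))"

definition contact :: "puiseux \<Rightarrow> puiseux \<Rightarrow> rat extended" where
  "contact \<alpha> \<gamma> = puiseux_ord (\<lambda>q. \<alpha> q - \<gamma> q)"

definition fractional_series :: "puiseux set" where
  "fractional_series = {\<alpha> \<in> puiseux_series. puiseux_ord \<alpha> > Fin 0}"

text \<open>The Puiseux series \<open>f(x, \<gamma>(x))\<close>, for a fractional power series \<open>\<gamma>\<close>.\<close>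
definition subst_puiseux :: "bseries \<Rightarrow> puiseux \<Rightarrow> puiseux" where
  "subst_puiseux f \<gamma> =
     (let N = puiseux_index \<gamma> in of_root N (subst_snd (ramify N f) (to_root N \<gamma>)))"

definition Zer :: "bseries \<Rightarrow> puiseux set" where
  "Zer g = {\<gamma> \<in> fractional_series. subst_puiseux g \<gamma> = (\<lambda>_. 0)}"

section \<open>The tree model\<close>

definition pseudo_ball :: "puiseux \<Rightarrow> rat \<Rightarrow> puiseux set" where
  "pseudo_ball \<alpha> h = {\<gamma> \<in> puiseux_series. contact \<gamma> \<alpha> \<ge> Fin h}"

text \<open>The height is determined by the ball as a set: it is the least contact of the
  centre with the elements of the ball.\<close>
definition height :: "puiseux set \<Rightarrow> rat" where
  "height B = (THE h. h > 0 \<and> (\<exists>\<alpha>\<in>puiseux_series. B = pseudo_ball \<alpha> h))"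

definition tree :: "bseries \<Rightarrow> puiseux set set" where
  "tree f = {pseudo_ball \<alpha> h | \<alpha> \<alpha>' h.
     \<alpha> \<in> Zer f \<and> \<alpha>' \<in> Zer f \<and> \<alpha> \<noteq> \<alpha>' \<and> contact \<alpha> \<alpha>' = Fin h}"

text \<open>\<open>\<lambda>\<^sub>B\<close>; all elements of \<open>B\<close> have the same terms of order below the height.\<close>
definition ball_stem :: "puiseux set \<Rightarrow> puiseux" where
  "ball_stem B = (\<lambda>q. if q < height B then (SOME \<alpha>. \<alpha> \<in> B) q else 0)"

text \<open>\<open>F = F\<^sub>B\<close> and \<open>q = q(B)\<close>: the condition on \<open>\<gamma>\<close> and \<open>c\<close> says
  \<open>\<gamma> = \<lambda>\<^sub>B + c x^{h(B)} + \<dots>\<close>, the conclusion says \<open>f(x, \<gamma>(x)) = F(c) x^q + \<dots>\<close>.\<close>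
definition leading_data :: "bseries \<Rightarrow> puiseux set \<Rightarrow> complex poly \<Rightarrow> rat \<Rightarrow> bool" where
  "leading_data f B F q \<longleftrightarrow> F \<noteq> 0 \<and>
     (\<forall>\<gamma>\<in>puiseux_series. \<forall>c.
        (\<forall>s<height B. \<gamma> s = ball_stem B s) \<and> \<gamma> (height B) = c \<longrightarrow>
        (\<forall>s<q. subst_puiseux f \<gamma> s = 0) \<and> subst_puiseux f \<gamma> q = poly F c)"

text \<open>In the following, \<open>\<alpha> 1, \<dots>, \<alpha> p\<close> are the Newton-Puiseux roots of \<open>f\<close> and
  \<open>\<gamma> 1, \<dots>, \<gamma> (p - 1)\<close> those of \<open>\<partial>f/\<partial>y\<close>, with multiplicity.\<close>

definition leaves_tree_at :: "(nat \<Rightarrow> puiseux) \<Rightarrow> nat \<Rightarrow> puiseux \<Rightarrow> puiseux set \<Rightarrow> bool" where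
  "leaves_tree_at \<alpha> p g B \<longleftrightarrow>
     g \<in> B \<and> Fin (height B) = Max ((\<lambda>i. contact (\<alpha> i) g) ` {1..p})"

section \<open>Conjugation and the polynomials \<open>\<D>\<close>\<close>

text \<open>The action of a \<open>D\<close>-th root of unity \<open>\<theta>\<close> on \<open>\<complex>{x^{1/D}}\<close>.\<close>
definition conj_series :: "nat \<Rightarrow> complex \<Rightarrow> puiseux \<Rightarrow> puiseux" where
  "conj_series D \<theta> \<alpha> = (\<lambda>q. \<theta> ^ nat \<lfloor>q * of_nat D\<rfloor> * \<alpha> q)"

text \<open>The orbit of \<open>B \<in> T(f)\<close>. The ball \<open>\<theta> * B\<close> does not depend on the root \<open>\<alpha>\<close> of \<open>f\<close>
  that is used as a centre of \<open>B\<close>, so all of them are allowed.\<close>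
definition ball_orbit :: "bseries \<Rightarrow> nat \<Rightarrow> puiseux set \<Rightarrow> puiseux set set" where
  "ball_orbit f D B =
     {pseudo_ball (conj_series D \<theta> \<alpha>) (height B) | \<theta> \<alpha>. \<theta> ^ D = 1 \<and> \<alpha> \<in> Zer f \<and> \<alpha> \<in> B}"

text \<open>\<open>\<D>\<^sub>B\<close>, written in the variables \<open>s = u^{1/D}\<close> and \<open>v\<close>.\<close>
definition disc_ball ::
  "bseries \<Rightarrow> (nat \<Rightarrow> puiseux) \<Rightarrow> (nat \<Rightarrow> puiseux) \<Rightarrow> nat \<Rightarrow> nat \<Rightarrow> puiseux set \<Rightarrow> bseries" where
  "disc_ball f \<alpha> \<gamma> p D B =
     (\<Prod>j\<in>{j\<in>{1..p-1}. leaves_tree_at \<alpha> p (\<gamma> j) B}.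
        fps_X - fps_const (to_root D (subst_puiseux f (\<gamma> j))))"

text \<open>The product of the \<open>\<D>\<^sub>B\<^sub>'\<close> over the orbit of \<open>B\<close>, written in \<open>u, v\<close>: since it lies in
  \<open>\<complex>{u}[v]\<close>, it is \<open>Q(s^D, v)\<close> for a series \<open>Q(u, v)\<close>, which is unique.\<close>
definition disc_orbit ::
  "bseries \<Rightarrow> (nat \<Rightarrow> puiseux) \<Rightarrow> (nat \<Rightarrow> puiseux) \<Rightarrow> nat \<Rightarrow> nat \<Rightarrow> puiseux set \<Rightarrow> bseries" where
  "disc_orbit f \<alpha> \<gamma> p D B =
     (THE Q. ramify D Q = (\<Prod>B'\<in>ball_orbit f D B. disc_ball f \<alpha> \<gamma> p D B'))"

section \<open>Newton diagrams\<close>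

definition newton_diagram :: "bseries \<Rightarrow> (real \<times> real) set" where
  "newton_diagram g =
     convex hull {(real i + a, real j + b) | i j a b. bcoeff g i j \<noteq> 0 \<and> a \<ge> 0 \<and> b \<ge> 0}"

definition newton_initial :: "bseries \<Rightarrow> bseries" where
  "newton_initial g = Abs_fps (\<lambda>j. Abs_fps (\<lambda>i.
     if \<exists>E. E edge_of newton_diagram g \<and> compact E \<and> (real i, real j) \<in> E
     then bcoeff g i j else 0))"

text \<open>\<open>v^M - w u^L\<close>.\<close>
definition quasi_factor :: "nat \<Rightarrow> nat \<Rightarrow> complex \<Rightarrow> bseries" where
  "quasi_factor M L w = fps_X ^ M - fps_const (fps_const w * fps_X ^ L)"

end

theory Submission
  imports Defs
begin

text \<open>
  Work in \<open>s = x^{1/D}\<close>. For \<open>g = \<lambda>\<^sub>B + c s^e + \<dots>\<close>, where \<open>e = D h(B)\<close>, the factorization of \<open>f\<close> gives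
  \<open>f(g) = F(c) s^Q + \<dots>\<close> with \<open>F\<close> a constant times the product of \<open>c - c\<^sub>i\<close> over the roots
  \<open>\<alpha>\<^sub>i \<in> B\<close>, and the product rule gives \<open>s^e f\<^sub>y(g) = F'(c) s^Q + \<dots>\<close>. Comparing with the
  factorization of \<open>f\<^sub>y\<close>, the coefficients at \<open>s^e\<close> of the \<open>\<gamma>\<^sub>j \<in> B\<close> are the roots of \<open>F'\<close>
  with multiplicity, and \<open>\<gamma>\<^sub>j\<close> leaves the tree at \<open>B\<close> iff \<open>F\<close> does not vanish there.

  The orbit of \<open>B\<close> consists of the \<open>N\<close> balls \<open>\<omega>^k * B\<close>, where \<open>\<omega>\<close> is a primitive \<open>D\<close>-th root of
  unity and \<open>k < N\<close>. Hence the product over the orbit is a product of factors \<open>v - b\<close> with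
  \<open>b = \<omega>^{kQ} F(c) s^Q + \<dots>\<close>, so its Newton diagram has exactly one compact edge and the initial
  form is the product of the \<open>v - \<omega>^{kQ} F(c) s^Q\<close>. Differentiating \<open>H(z^n) = F(z)^M\<close> shows that
  the relevant \<open>c\<close> are \<open>0\<close> (\<open>n - 1\<close> times, if \<open>H(0) \<noteq> 0\<close>) and the solutions of \<open>c^n = t\<^sub>j\<close>. Since
  \<open>\<omega>^N\<close> fixes \<open>\<lambda>\<^sub>B\<close>, we have \<open>F(\<omega>^{Ne} c) = \<omega>^{NQ} F(c)\<close>, where \<open>\<omega>^{Ne}\<close> and \<open>\<omega>^Q\<close> are primitive roots
  of unity of orders \<open>n\<close> and \<open>M\<close>; so the \<open>nN\<close> factors that belong to \<open>t\<^sub>j\<close> are \<open>v - \<omega>^{kQ} F(c) s^Q\<close>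
  with \<open>k < nN\<close>, whose product is a power of \<open>v^M - w\<^sub>j u^L\<close>.
\<close>

subsection \<open>Substitution for the first variable\<close>

text \<open>One operation covers both changes of the first variable: \<open>a = fps_X ^ D\<close> is
  ramification, \<open>a = fps_const \<theta> * fps_X\<close> is conjugation by a root of
  unity.\<close>

definition comp_fst :: "complex fps \<Rightarrow> bseries \<Rightarrow> bseries" where
  "comp_fst a G = Abs_fps (\<lambda>j. fps_compose (fps_nth G j) a)"

lemma comp_fst_nth [simp]: "fps_nth (comp_fst a G) j = fps_compose (fps_nth G j) a"
  by (simp add: comp_fst_def)

lemma ramify_eq_comp_fst: "ramify D = comp_fst (fps_X ^ D)"
  by (simp add: fun_eq_iff ramify_def comp_fst_def)

lemma comp_fst_diff: "comp_fst a (G - G') = comp_fst a G - comp_fst a G'"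
  by (simp add: fps_eq_iff[where 'a="complex fps"] fps_compose_sub_distrib)

lemma comp_fst_mult:
  assumes "fps_nth a 0 = 0"
  shows "comp_fst a (G * G') = comp_fst a G * comp_fst a G'"
  by (simp add: fps_eq_iff[where 'a="complex fps"] fps_mult_nth fps_compose_sum_distrib
      fps_compose_mult_distrib[OF assms])

lemma comp_fst_1 [simp]: "comp_fst a 1 = 1"
  by (simp add: fps_eq_iff[where 'a="complex fps"])

lemma comp_fst_X [simp]: "comp_fst a fps_X = fps_X"
  by (simp add: fps_eq_iff[where 'a="complex fps"] fps_X_def)

lemma comp_fst_const [simp]: "comp_fst a (fps_const c) = fps_const (fps_compose c a)"
  by (simp add: fps_eq_iff[where 'a="complex fps"])

lemma comp_fst_power:
  assumes "fps_nth a 0 = 0"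
  shows "comp_fst a (G ^ k) = comp_fst a G ^ k"
  by (induction k) (simp_all add: comp_fst_mult[OF assms])

lemma comp_fst_prod:
  assumes "fps_nth a 0 = 0"
  shows "comp_fst a (\<Prod>i\<in>I. G i) = (\<Prod>i\<in>I. comp_fst a (G i))"
  by (induction I rule: infinite_finite_induct) (simp_all add: comp_fst_mult[OF assms])

lemma comp_fst_prod_mset:
  assumes "fps_nth a 0 = 0"
  shows "comp_fst a (\<Prod>x\<in>#A. G x) = (\<Prod>x\<in>#A. comp_fst a (G x))"
  by (induction A) (simp_all add: comp_fst_mult[OF assms])

lemma comp_fst_comp_fst:
  assumes "fps_nth a 0 = 0" "fps_nth b 0 = 0"
  shows "comp_fst b (comp_fst a G) = comp_fst (fps_compose a b) G"
  by (simp add: fps_eq_iff[where 'a="complex fps"] fps_compose_assoc[OF assms(2,1)])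

text \<open>The derivative is in the second variable and multiplies coefficients by integers, which
  composition with \<open>a\<close> fixes. This lets the factorization of \<open>fps_deriv f\<close>
  be compared with the derivative of the ramified \<open>f\<close>.\<close>

lemma comp_fst_deriv:
  assumes "fps_nth a 0 = 0"
  shows "comp_fst a (fps_deriv G) = fps_deriv (comp_fst a G)"
proof -
  have "fps_compose (1 + of_nat j) a = 1 + of_nat j" for j
    by (simp add: fps_compose_add_distrib flip: fps_of_nat)
  then show ?thesis
    by (simp add: fps_eq_iff[where 'a="complex fps"] fps_compose_mult_distrib[OF assms])
qed

lemma fps_X_power_compose:
  assumes "l > 0"
  shows "fps_compose (fps_X ^ k) (fps_X ^ l) = (fps_X ^ (k * l) :: complex fps)"
proof -
  have "fps_nth (fps_X ^ l) 0 = (0::complex)" using assms by simp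
  from fps_compose_power[OF this, of fps_X k] fps_X_fps_compose_startby0[OF this]
  show ?thesis by (simp add: mult.commute[of k] power_mult)
qed

lemma fps_compose_X_power_nth:
  assumes "k > 0"
  shows "fps_nth (fps_compose a (fps_X ^ k)) m = (if k dvd m then fps_nth a (m div k) else (0::complex))"
proof -
  have "fps_nth (fps_compose a (fps_X ^ k)) m = (\<Sum>i=0..m. if m = k * i then fps_nth a i else 0)"
    unfolding fps_compose_nth power_mult[symmetric] by (intro sum.cong) auto
  also have "\<dots> = (if k dvd m then fps_nth a (m div k) else 0)"
  proof (cases "k dvd m")
    case True
    then obtain l where l: "m = k * l" by auto
    have "(\<Sum>i=0..m. if m = k * i then fps_nth a i else 0) = (\<Sum>i=0..m. if i = l then fps_nth a i else 0)"
      using assms by (intro sum.cong) (auto simp: l)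
    also have "\<dots> = fps_nth a l" using assms by (simp add: l)
    finally show ?thesis using assms l by simp
  next
    case False
    then show ?thesis by (auto intro!: sum.neutral)
  qed
  finally show ?thesis .
qed

subsection \<open>Substitution for the second variable\<close>

lemma fps_mult_power_nth_eq_0:
  assumes "fps_nth g 0 = 0" "m < j"
  shows "fps_nth (a * g ^ j) m = (0::complex)"
  using startsby_zero_power_prefix[OF assms(1), of j] assms(2)
  by (auto simp: fps_mult_nth intro!: sum.neutral)

text \<open>As \<open>g ^ j\<close> has order at least \<open>j\<close>, one truncation at degree
  \<open>m\<close> computes all coefficients up to \<open>m\<close>; identities for
  \<open>subst_snd\<close> can thus be checked on finite sums.\<close>

lemma subst_snd_nth:
  assumes "fps_nth g 0 = 0" "i \<le> m"
  shows "fps_nth (subst_snd G g) i = fps_nth (\<Sum>j\<le>m. fps_nth G j * g ^ j) i"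
proof -
  have "fps_nth (fps_nth G j * g ^ j) i = 0" if "i < j" for j
    using assms(1) that by (rule fps_mult_power_nth_eq_0)
  then have "(\<Sum>j\<le>i. fps_nth (fps_nth G j * g ^ j) i) = (\<Sum>j\<le>m. fps_nth (fps_nth G j * g ^ j) i)"
    using assms(2) by (intro sum.mono_neutral_left) auto
  then show ?thesis by (simp add: subst_snd_def fps_sum_nth)
qed

lemma subst_snd_diff: "subst_snd (G - G') g = subst_snd G g - subst_snd G' g"
  by (simp add: fps_eq_iff subst_snd_def algebra_simps sum_subtractf)

lemma subst_snd_add: "subst_snd (G + G') g = subst_snd G g + subst_snd G' g"
  by (simp add: fps_eq_iff subst_snd_def algebra_simps sum.distrib)

lemma subst_snd_mult:
  assumes g: "fps_nth g 0 = 0"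
  shows "subst_snd (G * G') g = subst_snd G g * subst_snd G' g"
proof (rule fps_ext)
  fix m
  define T where "T = (\<lambda>G. \<Sum>j\<le>m. fps_nth G j * g ^ j)"
  have T: "fps_nth (subst_snd G g) i = fps_nth (T G) i" if "i \<le> m" for G i
    unfolding T_def by (rule subst_snd_nth[OF g that])
  define h where "h = (\<lambda>(i, j). fps_nth (fps_nth G i * fps_nth G' j * g ^ (i + j)) m)"
  have "fps_nth (subst_snd G g * subst_snd G' g) m = fps_nth (T G * T G') m"
    by (simp add: fps_mult_nth T)
  also have "T G * T G' = (\<Sum>(i, j)\<in>{..m} \<times> {..m}. fps_nth G i * fps_nth G' j * g ^ (i + j))"
    by (simp add: T_def sum_product sum.cartesian_product power_add mult_ac)
  also have "fps_nth \<dots> m = sum h ({..m} \<times> {..m})"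
    by (simp add: fps_sum_nth h_def case_prod_unfold)
  \<comment> \<open>Pairs with \<open>i + j > m\<close> vanish because \<open>g ^ (i + j)\<close>
    has order above \<open>m\<close>. The remaining triangle is then sliced along its
    antidiagonals.\<close>
  also have "\<dots> = sum h {(i, j). i + j \<le> m}"
    by (rule sum.mono_neutral_right)
      (auto simp: h_def not_le intro!: fps_mult_power_nth_eq_0 g)
  also have "{(i, j). i + j \<le> m} = (\<Union>k\<le>m. {(i, j). i + j = k})" by auto
  also have "sum h \<dots> = (\<Sum>k\<le>m. sum h {(i, j). i + j = k})"
  proof (rule sum.UNION_disjoint)
    have "{(i, j). i + j = k} \<subseteq> {..k} \<times> {..k}" for k :: nat by auto
    then show "\<forall>k\<in>{..m}. finite {(i, j). i + j = k}"
      by (meson finite_SigmaI finite_atMost finite_subset)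
  qed auto
  also have "\<dots> = (\<Sum>k\<le>m. \<Sum>i\<le>k. h (i, k - i))"
  proof (rule sum.cong[OF refl])
    fix k
    show "sum h {(i, j). i + j = k} = (\<Sum>i\<le>k. h (i, k - i))"
      by (rule sum.reindex_bij_witness[of _ "\<lambda>i. (i, k - i)" fst]) auto
  qed
  also have "\<dots> = fps_nth (subst_snd (G * G') g) m"
    by (simp add: subst_snd_def h_def fps_mult_nth[where 'a="complex fps"] sum_distrib_right
        fps_sum_nth atLeast0AtMost)
  finally show "fps_nth (subst_snd (G * G') g) m = fps_nth (subst_snd G g * subst_snd G' g) m" ..
qed

lemma subst_snd_const [simp]: "subst_snd (fps_const a) g = a"
proof (rule fps_ext)
  fix m
  have "fps_nth (subst_snd (fps_const a) g) m = (\<Sum>j\<le>m. if j = 0 then fps_nth a m else 0)"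
    unfolding subst_snd_def fps_nth_Abs_fps by (intro sum.cong) auto
  then show "fps_nth (subst_snd (fps_const a) g) m = fps_nth a m" by simp
qed

lemma subst_snd_X:
  assumes "fps_nth g 0 = 0"
  shows "subst_snd fps_X g = g"
proof (rule fps_ext)
  fix m
  have "fps_nth (subst_snd fps_X g) m = (\<Sum>j\<le>Suc m. if j = 1 then fps_nth g m else 0)"
    unfolding subst_snd_nth[OF assms le_SucI[OF le_refl]] fps_sum_nth
    by (intro sum.cong) (auto simp: fps_X_def)
  then show "fps_nth (subst_snd fps_X g) m = fps_nth g m" by simp
qed

lemma subst_snd_linear:
  assumes "fps_nth g 0 = 0"
  shows "subst_snd (fps_X - fps_const a) g = g - a"
  by (simp add: subst_snd_diff subst_snd_X[OF assms])

lemma subst_snd_1 [simp]: "subst_snd 1 g = 1"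
  using subst_snd_const[of 1 g] by simp

lemma subst_snd_prod:
  assumes "fps_nth g 0 = 0"
  shows "subst_snd (\<Prod>i\<in>I. G i) g = (\<Prod>i\<in>I. subst_snd (G i) g)"
  by (induction I rule: infinite_finite_induct) (simp_all add: subst_snd_mult[OF assms])

lemma subst_snd_nth_0: "fps_nth (subst_snd G g) 0 = fps_nth (fps_nth G 0) 0"
  by (simp add: subst_snd_def)

text \<open>Used with \<open>a = fps_X ^ k\<close> to compare different denominators, and with
  \<open>a = fps_const \<theta> * fps_X\<close> to conjugate values of \<open>f\<close> at Puiseux
  series.\<close>

lemma subst_snd_compose:
  assumes a: "fps_nth a 0 = 0" and g: "fps_nth g 0 = 0"
  shows "subst_snd (comp_fst a G) (fps_compose g a) = fps_compose (subst_snd G g) a"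
proof (rule fps_ext)
  fix m
  define T where "T = (\<Sum>j\<le>m. fps_nth G j * g ^ j)"
  have "fps_nth (fps_compose (subst_snd G g) a) m = fps_nth (fps_compose T a) m"
    unfolding fps_compose_nth T_def by (intro sum.cong) (auto simp: subst_snd_nth[OF g])
  also have "fps_compose T a = (\<Sum>j\<le>m. fps_compose (fps_nth G j) a * fps_compose g a ^ j)"
    by (simp add: T_def fps_compose_sum_distrib fps_compose_mult_distrib[OF a] fps_compose_power[OF a])
  also have "fps_nth \<dots> m = fps_nth (subst_snd (comp_fst a G) (fps_compose g a)) m"
    by (simp add: subst_snd_def fps_sum_nth)
  finally show "fps_nth (subst_snd (comp_fst a G) (fps_compose g a)) m =
    fps_nth (fps_compose (subst_snd G g) a) m" ..
qed

subsection \<open>Leading coefficients\<close>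

text \<open>The value \<open>c = 0\<close> is allowed, so this only bounds the order from below and
  names one coefficient. It is therefore stable under sums, and \<open>c\<close> may be the value of
  a polynomial that vanishes at some points.\<close>

definition lead :: "complex fps \<Rightarrow> nat \<Rightarrow> complex \<Rightarrow> bool" where
  "lead a k c \<longleftrightarrow> (\<forall>i<k. fps_nth a i = 0) \<and> fps_nth a k = c"

lemma lead_0 [simp]: "lead 0 k c \<longleftrightarrow> c = 0"
  by (auto simp: lead_def)

lemma lead_1: "lead 1 0 1"
  by (simp add: lead_def)

lemma lead_add: "lead a k c \<Longrightarrow> lead b k d \<Longrightarrow> lead (a + b) k (c + d)"
  by (auto simp: lead_def)

lemma lead_mult:
  assumes "lead a k c" "lead b l d"
  shows "lead (a * b) (k + l) (c * d)"
proof -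
  have *: "fps_nth a i * fps_nth b (m - i) = (if m = k + l \<and> i = k then c * d else 0)"
    if "m \<le> k + l" "i \<le> m" for m i
  proof (cases "i < k")
    case False
    then have "m - i < l \<or> m = k + l \<and> i = k" using that by linarith
    then show ?thesis using assms by (auto simp: lead_def)
  qed (use assms in \<open>auto simp: lead_def\<close>)
  have "fps_nth (a * b) m = (if m = k + l then c * d else 0)" if "m \<le> k + l" for m
  proof -
    have "fps_nth (a * b) m = (\<Sum>i=0..m. if m = k + l \<and> i = k then c * d else 0)"
      unfolding fps_mult_nth using * that by (intro sum.cong) auto
    also have "\<dots> = (if m = k + l then c * d else 0)" by simp
    finally show ?thesis .
  qed
  then show ?thesis by (auto simp: lead_def)
qed

lemma lead_unique:
  assumes "lead a k c" "lead a l d" "c \<noteq> 0" "d \<noteq> 0"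
  shows "k = l" "c = d"
proof -
  show "k = l" using assms by (auto simp: lead_def) (metis linorder_neqE_nat)
  then show "c = d" using assms by (auto simp: lead_def)
qed

text \<open>Some complex number is a root of neither polynomial; there the order of the series fixes
  the exponent. Once the exponents agree, so do the values at every point.\<close>

lemma lead_poly_unique:
  fixes p p' :: "complex poly"
  assumes "\<And>c. lead (x c) k (poly p c)" "\<And>c. lead (x c) k' (poly p' c)" "p \<noteq> 0" "p' \<noteq> 0"
  shows "k = k'" "p = p'"
proof -
  have "p * p' \<noteq> 0" using assms by simp
  then have "finite {c. poly (p * p') c = 0}" by (rule poly_roots_finite)
  then obtain c where "poly (p * p') c \<noteq> 0"
    using infinite_UNIV_char_0[where 'a=complex] by (metis (mono_tags, lifting) finite_subset mem_Collect_eq subsetI)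
  then show "k = k'" using lead_unique(1)[OF assms(1)[of c] assms(2)[of c]] by simp
  then show "p = p'" using assms(1,2) by (auto simp: poly_eq_poly_eq_iff[symmetric] lead_def fun_eq_iff)
qed

text \<open>In the variable \<open>s\<close> this is contact order at least \<open>e\<close>. For
  \<open>e = D h(B)\<close> and \<open>h\<close> the stem of \<open>B\<close> it expresses
  membership in \<open>B\<close>.\<close>

definition agree :: "nat \<Rightarrow> complex fps \<Rightarrow> complex fps \<Rightarrow> bool" where
  "agree e g h \<longleftrightarrow> (\<forall>i<e. fps_nth g i = fps_nth h i)"

lemma agree_sym: "agree e g h \<Longrightarrow> agree e h g"
  by (simp add: agree_def)

lemma agree_trans: "agree e g h \<Longrightarrow> agree e h k \<Longrightarrow> agree e g k"
  by (simp add: agree_def)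

text \<open>Induction on the factors: if \<open>a i\<close> agrees with \<open>lam\<close> below
  \<open>e\<close>, then \<open>g - a i\<close> starts with
  \<open>(fps_nth g e - fps_nth (a i) e) s^e\<close>; otherwise it starts below \<open>e\<close>
  with a coefficient independent of \<open>g\<close>. The factor \<open>fps_X ^ e\<close> makes up
  for the order lost when a factor is differentiated away, so value and derivative are read off at
  the same \<open>Q\<close>.\<close>

lemma lead_family:
  fixes a :: "'i \<Rightarrow> complex fps"
  assumes "finite I"
  shows "\<exists>Q K. K \<noteq> 0 \<and> (\<forall>g. fps_nth g 0 = 0 \<longrightarrow> agree e g lam \<longrightarrow>
    lead (subst_snd (\<Prod>i\<in>I. fps_X - fps_const (a i)) g) Q
      (poly (smult K (\<Prod>i\<in>{i\<in>I. agree e (a i) lam}. [:- fps_nth (a i) e, 1:])) (fps_nth g e)) \<and>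
    lead (fps_X ^ e * subst_snd (fps_deriv (\<Prod>i\<in>I. fps_X - fps_const (a i))) g) Q
      (poly (pderiv (smult K (\<Prod>i\<in>{i\<in>I. agree e (a i) lam}. [:- fps_nth (a i) e, 1:])))
        (fps_nth g e)))"
  using assms
proof (induction I rule: finite_induct)
  case empty
  have "subst_snd 0 g = 0" for g by (simp add: fps_eq_iff subst_snd_def)
  then show ?case by (intro exI[of _ 0] exI[of _ 1]) (auto simp: lead_1)
next
  case (insert j I)
  define P where "P = (\<Prod>i\<in>I. fps_X - fps_const (a i))"
  define R where "R = (\<Prod>i\<in>{i\<in>I. agree e (a i) lam}. [:- fps_nth (a i) e, 1:])"
  obtain Q K where K: "K \<noteq> 0" and
    IH': "\<forall>g. fps_nth g 0 = 0 \<longrightarrow> agree e g lam \<longrightarrow>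
      lead (subst_snd P g) Q (poly (smult K R) (fps_nth g e)) \<and>
      lead (fps_X ^ e * subst_snd (fps_deriv P) g) Q (poly (pderiv (smult K R)) (fps_nth g e))"
    using insert.IH[folded P_def R_def] by blast
  have IH:
      "lead (subst_snd P g) Q (poly (smult K R) (fps_nth g e))"
      "lead (fps_X ^ e * subst_snd (fps_deriv P) g) Q (poly (pderiv (smult K R)) (fps_nth g e))"
    if "fps_nth g 0 = 0" "agree e g lam" for g
    using IH' that by blast+
  have P': "(\<Prod>i\<in>insert j I. fps_X - fps_const (a i)) = (fps_X - fps_const (a j)) * P"
    using insert.hyps by (simp add: P_def)
  have val: "subst_snd ((fps_X - fps_const (a j)) * P) g = (g - a j) * subst_snd P g"
    if "fps_nth g 0 = 0" for g
    by (simp add: subst_snd_mult[OF that] subst_snd_linear[OF that])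
  have der: "fps_X ^ e * subst_snd (fps_deriv ((fps_X - fps_const (a j)) * P)) g =
      fps_X ^ e * subst_snd P g + (g - a j) * (fps_X ^ e * subst_snd (fps_deriv P) g)"
    if "fps_nth g 0 = 0" for g
  proof -
    have "fps_deriv ((fps_X - fps_const (a j)) * P) = P + (fps_X - fps_const (a j)) * fps_deriv P"
      by simp
    then show ?thesis
      by (simp only: subst_snd_add subst_snd_mult[OF that] subst_snd_linear[OF that])
        (simp add: algebra_simps)
  qed
  have Xe: "lead (fps_X ^ e) e 1" by (simp add: lead_def)
  show ?case
  proof (cases "agree e (a j) lam")
    case True
    then have "{i \<in> insert j I. agree e (a i) lam} = insert j {i \<in> I. agree e (a i) lam}" by auto
    then have R': "(\<Prod>i\<in>{i\<in>insert j I. agree e (a i) lam}. [:- fps_nth (a i) e, 1:])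
        = [:- fps_nth (a j) e, 1:] * R"
      using insert.hyps by (simp add: R_def)
    show ?thesis unfolding P' R'
    proof (intro exI[of _ "e + Q"] exI[of _ K] conjI allI impI K)
      fix g :: "complex fps" assume g: "fps_nth g 0 = 0" "agree e g lam"
      have l: "lead (g - a j) e (fps_nth g e - fps_nth (a j) e)"
        using g True by (auto simp: lead_def agree_def)
      show "lead (subst_snd ((fps_X - fps_const (a j)) * P) g) (e + Q)
          (poly (smult K ([:- fps_nth (a j) e, 1:] * R)) (fps_nth g e))"
        using lead_mult[OF l IH(1)[OF g]] unfolding val[OF g(1)] by (simp add: algebra_simps)
      \<comment> \<open>The product rule for polynomials mirrors the one for series: the first
        summand comes from differentiating the new linear factor.\<close>
      have "1 * poly (smult K R) y + (y - x) * poly (pderiv (smult K R)) y =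
          poly (pderiv (smult K ([:- x, 1:] * R))) y" for x y
        by (simp only: pderiv_smult pderiv_mult pderiv_pCons) (simp add: algebra_simps)
      with lead_add[OF lead_mult[OF Xe IH(1)[OF g]] lead_mult[OF l IH(2)[OF g]]]
      show "lead (fps_X ^ e * subst_snd (fps_deriv ((fps_X - fps_const (a j)) * P)) g) (e + Q)
          (poly (pderiv (smult K ([:- fps_nth (a j) e, 1:] * R))) (fps_nth g e))"
        unfolding der[OF g(1)] by metis
    qed
  next
    case False
    then have "{i \<in> insert j I. agree e (a i) lam} = {i \<in> I. agree e (a i) lam}" by auto
    then have R': "(\<Prod>i\<in>{i\<in>insert j I. agree e (a i) lam}. [:- fps_nth (a i) e, 1:]) = R"
      by (simp add: R_def)
    \<comment> \<open>The order of \<open>lam - a j\<close>. It lies below \<open>e\<close>, so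
      \<open>g - a j\<close> has this order and leading coefficient \<open>d\<close> for every
      admissible \<open>g\<close>.\<close>
    define k where "k = (LEAST k. fps_nth lam k \<noteq> fps_nth (a j) k)"
    define d where "d = fps_nth lam k - fps_nth (a j) k"
    obtain k0 where k0: "k0 < e" "fps_nth lam k0 \<noteq> fps_nth (a j) k0"
      using False by (auto simp: agree_def)
    have k: "fps_nth lam k \<noteq> fps_nth (a j) k" unfolding k_def by (rule LeastI) (rule k0(2))
    have "k \<le> k0" unfolding k_def by (rule Least_le) (rule k0(2))
    then have "k < e" using k0 by simp
    have below: "fps_nth lam i = fps_nth (a j) i" if "i < k" for i
      using not_less_Least[of i] that unfolding k_def by blast
    show ?thesis unfolding P' R'
    proof (intro exI[of _ "k + Q"] exI[of _ "d * K"] conjI allI impI)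
      show "d * K \<noteq> 0" using K k by (simp add: d_def)
      fix g :: "complex fps" assume g: "fps_nth g 0 = 0" "agree e g lam"
      have l: "lead (g - a j) k d"
        using g \<open>k < e\<close> below by (auto simp: lead_def agree_def d_def)
      show "lead (subst_snd ((fps_X - fps_const (a j)) * P) g) (k + Q)
          (poly (smult (d * K) R) (fps_nth g e))"
        using lead_mult[OF l IH(1)[OF g]] unfolding val[OF g(1)] by (simp add: algebra_simps)
      \<comment> \<open>The summand in which the new factor is differentiated starts no earlier than
        \<open>e + Q > k + Q\<close>, so the new factor enters only through the constant
        \<open>d\<close>.\<close>
      have "lead (fps_X ^ e * subst_snd P g) (k + Q) 0"
        using lead_mult[OF Xe IH(1)[OF g]] \<open>k < e\<close> by (simp add: lead_def)
      from lead_add[OF this lead_mult[OF l IH(2)[OF g]]]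
      show "lead (fps_X ^ e * subst_snd (fps_deriv ((fps_X - fps_const (a j)) * P)) g) (k + Q)
          (poly (pderiv (smult (d * K) R)) (fps_nth g e))"
        unfolding der[OF g(1)] by (simp add: pderiv_smult mult.assoc)
    qed
  qed
qed

text \<open>The unit contributes only its value at the origin; the term with
  \<open>fps_deriv V\<close> carries \<open>s^e\<close> with \<open>e > 0\<close> and lies above
  order \<open>Q\<close>.\<close>

lemma lead_unit_family:
  fixes a :: "'i \<Rightarrow> complex fps"
  assumes "finite I" "e > 0" and V: "fps_nth (fps_nth V 0) 0 \<noteq> 0"
  defines "G \<equiv> V * (\<Prod>i\<in>I. fps_X - fps_const (a i))"
  shows "\<exists>Q K p. K \<noteq> 0 \<and> p = smult K (\<Prod>i\<in>{i\<in>I. agree e (a i) lam}. [:- fps_nth (a i) e, 1:]) \<and>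
    (\<forall>g. fps_nth g 0 = 0 \<longrightarrow> agree e g lam \<longrightarrow>
      lead (subst_snd G g) Q (poly p (fps_nth g e)) \<and>
      lead (fps_X ^ e * subst_snd (fps_deriv G) g) Q (poly (pderiv p) (fps_nth g e)))"
proof -
  define P where "P = (\<Prod>i\<in>I. fps_X - fps_const (a i))"
  define R where "R = (\<Prod>i\<in>{i\<in>I. agree e (a i) lam}. [:- fps_nth (a i) e, 1:])"
  define v where "v = fps_nth (fps_nth V 0) 0"
  obtain Q K where K: "K \<noteq> 0" and
    IH': "\<forall>g. fps_nth g 0 = 0 \<longrightarrow> agree e g lam \<longrightarrow>
      lead (subst_snd P g) Q (poly (smult K R) (fps_nth g e)) \<and>
      lead (fps_X ^ e * subst_snd (fps_deriv P) g) Q (poly (pderiv (smult K R)) (fps_nth g e))"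
    using lead_family[OF assms(1), of e lam a, folded P_def R_def] by blast
  have IH:
      "lead (subst_snd P g) Q (poly (smult K R) (fps_nth g e))"
      "lead (fps_X ^ e * subst_snd (fps_deriv P) g) Q (poly (pderiv (smult K R)) (fps_nth g e))"
    if "fps_nth g 0 = 0" "agree e g lam" for g
    using IH' that by blast+
  have V0: "lead (subst_snd V g) 0 v" for g
    by (simp add: lead_def subst_snd_nth_0 v_def)
  show ?thesis
  proof (intro exI[of _ Q] exI[of _ "v * K"] exI[of _ "smult (v * K) R"] conjI allI impI)
    show "v * K \<noteq> 0" using K V by (simp add: v_def)
    show "smult (v * K) R = smult (v * K) (\<Prod>i\<in>{i\<in>I. agree e (a i) lam}. [:- fps_nth (a i) e, 1:])"
      by (simp add: R_def)
    fix g :: "complex fps" assume g: "fps_nth g 0 = 0" "agree e g lam"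
    show "lead (subst_snd G g) Q (poly (smult (v * K) R) (fps_nth g e))"
      using lead_mult[OF V0 IH(1)[OF g]]
      by (simp add: G_def P_def[symmetric] subst_snd_mult[OF g(1)] mult_ac)
    have "lead (fps_X ^ e) e 1" by (simp add: lead_def)
    from lead_mult[OF this lead_mult[OF _ IH(1)[OF g], of "subst_snd (fps_deriv V) g" 0]]
    have "lead (fps_X ^ e * (subst_snd (fps_deriv V) g * subst_snd P g)) Q 0"
      using \<open>e > 0\<close> by (simp add: lead_def)
    from lead_add[OF this lead_mult[OF V0 IH(2)[OF g], unfolded add_0]]
    show "lead (fps_X ^ e * subst_snd (fps_deriv G) g) Q (poly (pderiv (smult (v * K) R)) (fps_nth g e))"
      by (simp add: G_def P_def[symmetric] subst_snd_mult[OF g(1)] subst_snd_add pderiv_smult algebra_simps)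
  qed
qed

subsection \<open>Products of linear factors\<close>

text \<open>Both products are images of polynomials under the injective map
  \<open>fps_of_poly\<close>, and a product of linear polynomials over a domain recovers its
  multiset of roots.\<close>

lemma prod_mset_linear_inj:
  fixes A A' :: "'a::idom multiset"
  assumes "(\<Prod>a\<in>#A. fps_X - fps_const a) = (\<Prod>a\<in>#A'. fps_X - fps_const a)"
  shows "A = A'"
proof -
  define P where "P = (\<lambda>A. \<Prod>a\<in>#A. [:-a, 1:] :: 'a poly)"
  have "fps_of_poly [:- x, 1:] = fps_X - fps_const x" for x :: 'a
    by (simp add: fps_of_poly_pCons flip: fps_const_neg)
  then have "fps_of_poly (P A) = (\<Prod>a\<in>#A. fps_X - fps_const a)" for A
    by (induction A) (simp_all add: P_def fps_of_poly_mult del: mult_pCons_left)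
  then have "P A = P A'" using assms fps_of_poly_eq_iff by metis
  moreover have "proots (P A) = A" for A
  proof (induction A)
    case (add x A)
    have "P A \<noteq> 0" for A by (auto simp: P_def)
    then show ?case using add by (simp add: P_def proots_mult del: mult_pCons_left)
  qed (simp add: P_def)
  ultimately show ?thesis by metis
qed

text \<open>The conjugation \<open>a(s) \<mapsto> a(\<theta> s)\<close> in the variable \<open>s = x^{1/D}\<close>.\<close>
abbreviation rot :: "complex \<Rightarrow> complex fps \<Rightarrow> complex fps" where
  "rot \<theta> a \<equiv> fps_compose a (fps_const \<theta> * fps_X)"

lemma rot_nth: "fps_nth (rot \<theta> a) k = \<theta> ^ k * fps_nth a k"
  by (simp add: fps_compose_linear)

lemma rot_1 [simp]: "rot 1 a = a"
  by (simp add: fps_eq_iff rot_nth)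

lemma rot_rot: "rot \<theta> (rot \<theta>' a) = rot (\<theta> * \<theta>') a"
  by (simp add: fps_eq_iff rot_nth power_mult_distrib)

lemma lead_rot: "lead a k c \<Longrightarrow> lead (rot \<theta> a) k (\<theta> ^ k * c)"
  by (simp add: lead_def rot_nth)

lemma rot_ramify:
  assumes "\<theta> ^ D = 1" "D > 0"
  shows "comp_fst (fps_const \<theta> * fps_X) (ramify D G) = ramify D G"
proof -
  have "fps_compose (fps_X ^ D) (fps_const \<theta> * fps_X) = fps_X ^ D"
    using assms by (auto simp: fps_eq_iff rot_nth)
  then show ?thesis using assms by (simp add: ramify_eq_comp_fst comp_fst_comp_fst)
qed

text \<open>Conjugation fixes all series in \<open>s^D\<close>, hence \<open>ramify D G\<close> and
  \<open>ramify D V\<close>. Cancelling the latter shows that the product of linear factors is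
  fixed, and this product determines its roots with multiplicity.\<close>

lemma conjugate_roots:
  assumes \<theta>: "\<theta> ^ D = 1" "D > 0" and "finite I"
    and V: "fps_nth (fps_nth V 0) 0 \<noteq> 0"
    and G: "ramify D G = ramify D V * (\<Prod>i\<in>I. fps_X - fps_const (a i))"
  defines "A \<equiv> image_mset a (mset_set I)"
  shows "image_mset (rot \<theta>) A = A"
proof -
  let ?\<sigma> = "comp_fst (fps_const \<theta> * fps_X)"
  have 0: "fps_nth (fps_const \<theta> * fps_X) 0 = 0" by simp
  have "(\<Prod>i\<in>I. fps_X - fps_const (a i)) = (\<Prod>a\<in>#A. fps_X - fps_const a)"
    by (simp add: A_def prod_unfold_prod_mset image_mset.compositionality comp_def)
  note G = G[unfolded this]
  have "ramify D V \<noteq> 0"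
  proof
    assume "ramify D V = 0"
    then have "fps_nth (fps_nth (ramify D V) 0) 0 = 0" by simp
    then show False using V by (simp add: ramify_eq_comp_fst)
  qed
  moreover have "ramify D V * (\<Prod>a\<in>#A. fps_X - fps_const a) =
      ramify D V * ?\<sigma> (\<Prod>a\<in>#A. fps_X - fps_const a)"
  proof -
    have "ramify D V * (\<Prod>a\<in>#A. fps_X - fps_const a) = ?\<sigma> (ramify D G)"
      by (subst rot_ramify[OF \<theta>]) (rule G[symmetric])
    also have "\<dots> = ramify D V * ?\<sigma> (\<Prod>a\<in>#A. fps_X - fps_const a)"
      by (simp only: G comp_fst_mult[OF 0] rot_ramify[OF \<theta>])
    finally show ?thesis .
  qed
  ultimately have "(\<Prod>a\<in>#A. fps_X - fps_const a) = ?\<sigma> (\<Prod>a\<in>#A. fps_X - fps_const a)"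
    by (metis mult_left_cancel)
  also have "\<dots> = (\<Prod>a\<in>#image_mset (rot \<theta>) A. fps_X - fps_const a)"
    by (simp add: comp_fst_prod_mset[OF 0] comp_fst_diff image_mset.compositionality comp_def)
  finally show ?thesis using prod_mset_linear_inj by metis
qed

subsection \<open>Leading forms of products of linear factors\<close>

lemma degree_prod_mset_linear:
  fixes f :: "'a \<Rightarrow> 'b::idom"
  shows "degree (\<Prod>a\<in>#A. [:- f a, 1:]) = size A"
proof (induction A)
  case (add x A)
  have "(\<Prod>a\<in>#A. [:- f a, 1:]) \<noteq> 0" by auto
  then show ?case using add by (simp add: degree_mult_eq del: mult_pCons_left)
qed simp

text \<open>Up to sign the coefficient of \<open>v^j\<close> is the elementary symmetric function of
  degree \<open>size A - j\<close> in the series \<open>b\<close>, each of order at least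
  \<open>Q\<close>. The induction splits off one factor at a time.\<close>

lemma lead_prod_mset_linear:
  assumes "\<forall>b\<in>#A. lead b Q (fps_nth b Q)"
  shows "(j \<le> size A \<longrightarrow> lead (fps_nth (\<Prod>b\<in>#A. fps_X - fps_const b) j) ((size A - j) * Q)
           (coeff (\<Prod>b\<in>#A. [:- fps_nth b Q, 1:]) j)) \<and>
         (j > size A \<longrightarrow> fps_nth (\<Prod>b\<in>#A. fps_X - fps_const b) j = 0)"
  using assms
proof (induction A arbitrary: j)
  case empty
  show ?case by (cases j) (auto simp: lead_def)
next
  case (add b A)
  define W where "W = (\<Prod>b\<in>#A. fps_X - fps_const b)"
  define P where "P = (\<Prod>b\<in>#A. [:- fps_nth b Q, 1:])"
  note IH = add.IH[folded W_def P_def]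
  have b: "lead (- b) Q (- fps_nth b Q)" using add.prems by (auto simp: lead_def)
  have W': "(\<Prod>b\<in>#add_mset b A. fps_X - fps_const b) = fps_X * W + fps_const (- b) * W"
    by (simp add: W_def algebra_simps flip: fps_const_neg)
  have P': "(\<Prod>b\<in>#add_mset b A. [:- fps_nth b Q, 1:]) = pCons 0 P + smult (- fps_nth b Q) P"
    by (simp add: P_def)
  have hyp: "\<forall>b\<in>#A. lead b Q (fps_nth b Q)" using add.prems by simp
  have IH1: "lead (fps_nth W j) ((size A - j) * Q) (coeff P j)" if "j \<le> size A" for j
    using IH[of j] hyp that by blast
  have IH2: "fps_nth W j = 0" if "j > size A" for j
    using IH[of j] hyp that by blast
  have dP: "coeff P j = 0" if "j > size A" for j
  proof -
    have "degree P = size A" unfolding P_def by (rule degree_prod_mset_linear)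
    then show ?thesis using that by (simp add: coeff_eq_0)
  qed
  have *: "lead (- b * fps_nth W j) ((Suc (size A) - j) * Q) (- fps_nth b Q * coeff P j)"
    if "j \<le> Suc (size A)" for j
  proof (cases "j \<le> size A")
    case True
    from lead_mult[OF b IH1[OF this]] True show ?thesis by (simp add: Suc_diff_le)
  next
    case False
    then show ?thesis using IH2[of j] dP[of j] by simp
  qed
  show ?case
  proof (cases j)
    case 0
    then show ?thesis unfolding W' P' using *[of 0] by simp
  next
    case (Suc i)
    have "lead (fps_nth W i + - b * fps_nth W j) ((Suc (size A) - j) * Q)
      (coeff P i + - fps_nth b Q * coeff P j)" if "j \<le> Suc (size A)"
      using lead_add[OF _ *[OF that]] IH1[of i] that Suc by simp
    then show ?thesis unfolding W' P' using Suc IH2 by (auto simp: coeff_pCons)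
  qed
qed

text \<open>The quasi-homogeneous leading form of \<open>v - b\<close> for
  \<open>b = a s^Q + ...\<close>, where \<open>s\<close> has weight 1 and \<open>v\<close> has
  weight \<open>Q\<close>.\<close>

definition hfactor :: "nat \<Rightarrow> complex \<Rightarrow> bseries" where
  "hfactor Q a = fps_X - fps_const (fps_const a * fps_X ^ Q)"

lemma prod_mset_hfactor_nth:
  "fps_nth (\<Prod>a\<in>#A. hfactor Q a) j =
     fps_const (coeff (\<Prod>a\<in>#A. [:- a, 1:]) j) * fps_X ^ ((size A - j) * Q)"
proof (induction A arbitrary: j)
  case empty
  show ?case by (cases j) auto
next
  case (add a A)
  define W where "W = (\<Prod>a\<in>#A. hfactor Q a)"
  define P where "P = (\<Prod>a\<in>#A. [:- a, 1:])"
  note IH = add.IH[folded W_def P_def]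
  have W': "(\<Prod>b\<in>#add_mset a A. hfactor Q b) = fps_X * W + fps_const (- fps_const a * fps_X ^ Q) * W"
    by (simp add: W_def hfactor_def algebra_simps flip: fps_const_neg)
  have P': "(\<Prod>b\<in>#add_mset a A. [:- b, 1:]) = pCons 0 P + smult (- a) P"
    by (simp add: P_def)
  have dP: "coeff P j = 0" if "j > size A" for j
  proof -
    have "degree P = size A" unfolding P_def by (rule degree_prod_mset_linear)
    then show ?thesis using that by (simp add: coeff_eq_0)
  qed
  have *: "- fps_const a * fps_X ^ Q * fps_nth W j =
      fps_const (- a * coeff P j) * fps_X ^ ((Suc (size A) - j) * Q)" for j
  proof (cases "j \<le> size A")
    case True
    then show ?thesis unfolding IH
      by (simp add: Suc_diff_le power_add mult_ac flip: fps_const_mult fps_const_neg)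
  next
    case False
    then show ?thesis unfolding IH using dP[of j] by simp
  qed
  show ?case
  proof (cases j)
    case 0
    then show ?thesis unfolding W' P' using *[of 0] by simp
  next
    case (Suc i)
    then show ?thesis unfolding W' P' using *[of j] IH[of i]
      by (simp add: coeff_pCons left_diff_distrib flip: fps_const_sub)
  qed
qed

subsection \<open>Newton diagrams with one compact edge\<close>

text \<open>For positive \<open>q\<close> and \<open>R\<close> this is the Newton diagram whose
  compact edge joins \<open>(0, R)\<close> and \<open>(q R, 0)\<close>.\<close>

definition newton_halfplane :: "real \<Rightarrow> real \<Rightarrow> (real \<times> real) set" where
  "newton_halfplane q R = {(x, y). x \<ge> 0 \<and> y \<ge> 0 \<and> x + q * y \<ge> q * R}"

lemma convex_newton_halfplane: "convex (newton_halfplane q R)"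
proof -
  have "newton_halfplane q R = {z. (1, 0) \<bullet> z \<ge> 0} \<inter> {z. (0, 1) \<bullet> z \<ge> 0} \<inter> {z. (1, q) \<bullet> z \<ge> q * R}"
    by (auto simp: newton_halfplane_def)
  then show ?thesis by (simp add: convex_Int convex_halfspace_ge)
qed

lemma newton_diagram_eq:
  assumes q: "q > 0" and R: "R > 0"
    and ge: "\<And>i j. bcoeff G i j \<noteq> 0 \<Longrightarrow> real i + q * real j \<ge> q * real R"
    and end1: "bcoeff G 0 R \<noteq> 0" and end2: "real i0 = q * real R" "bcoeff G i0 0 \<noteq> 0"
  shows "newton_diagram G = newton_halfplane q R"
proof
  let ?S = "{(real i + a, real j + b) | i j a b. bcoeff G i j \<noteq> 0 \<and> a \<ge> 0 \<and> b \<ge> 0}"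
  have "?S \<subseteq> newton_halfplane q R"
  proof
    fix z assume "z \<in> ?S"
    then obtain i j a b where z: "z = (real i + a, real j + b)" and *: "bcoeff G i j \<noteq> 0" "a \<ge> 0" "b \<ge> 0"
      by auto
    have "q * b \<ge> 0" using q * by simp
    then show "z \<in> newton_halfplane q R"
      using ge[OF *(1)] * unfolding z newton_halfplane_def by (auto simp: algebra_simps)
  qed
  then show "newton_diagram G \<subseteq> newton_halfplane q R"
    unfolding newton_diagram_def by (rule hull_minimal) (rule convex_newton_halfplane)
  show "newton_halfplane q R \<subseteq> newton_diagram G"
  proof
    fix z assume "z \<in> newton_halfplane q R"
    then obtain x y where z: "z = (x, y)" and xy: "x \<ge> 0" "y \<ge> 0" "x + q * y \<ge> q * R"
      by (auto simp: newton_halfplane_def)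
    show "z \<in> newton_diagram G"
    proof (cases "y \<ge> R")
      case True
      have "z \<in> ?S" using end1 xy True unfolding z
        by (intro CollectI exI[of _ 0] exI[of _ R] exI[of _ x] exI[of _ "y - R"]) auto
      then show ?thesis unfolding newton_diagram_def by (rule hull_inc)
    next
      case False
      \<comment> \<open>The horizontal distance of \<open>z\<close> from the line. Both end points
        shifted right by \<open>d\<close> still belong to the generating set, and \<open>z\<close>
        divides the shifted segment with weight \<open>u\<close>.\<close>
      define d where "d = x - q * (R - y)"
      define u where "u = y / R"
      have d: "d \<ge> 0" using xy by (simp add: d_def algebra_simps)
      have u: "u \<ge> 0" "1 - u \<ge> 0" using xy R False by (auto simp: u_def field_simps)
      have P1: "(real 0 + d, real R + 0) \<in> ?S" using end1 d
        by (intro CollectI exI[of _ 0] exI[of _ R] exI[of _ d] exI[of _ "0::real"]) auto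
      have P2: "(real i0 + d, real 0 + 0) \<in> ?S" using end2 d
        by (intro CollectI exI[of _ i0] exI[of _ 0] exI[of _ d] exI[of _ "0::real"]) auto
      have "u *\<^sub>R (real 0 + d, real R + 0) + (1 - u) *\<^sub>R (real i0 + d, real 0 + 0) = z"
        using R by (simp add: z d_def u_def end2(1) field_simps)
      moreover have "u *\<^sub>R (real 0 + d, real R + 0) + (1 - u) *\<^sub>R (real i0 + d, real 0 + 0)
          \<in> newton_diagram G"
        unfolding newton_diagram_def
        by (rule convexD[OF convex_convex_hull hull_inc[OF P1] hull_inc[OF P2] u]) simp
      ultimately show ?thesis by simp
    qed
  qed
qed

lemma compact_face_newton_halfplane:
  assumes q: "q > 0" and R: "R > 0"
    and E: "E face_of newton_halfplane q R" "compact E" and z: "(x, y) \<in> E"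
  shows "x + q * y = q * R"
proof (rule ccontr)
  assume "x + q * y \<noteq> q * R"
  moreover have z': "(x, y) \<in> newton_halfplane q R" using face_of_imp_subset[OF E(1)] z by blast
  ultimately have gt: "x + q * y > q * R" and xy: "x \<ge> 0" "y \<ge> 0"
    by (auto simp: newton_halfplane_def)
  text \<open>A point above the line lies inside a ray of the half-plane; a face contains that ray.\<close>
  obtain v \<epsilon> where v: "norm v = 1" "\<epsilon> > 0" "(x, y) - \<epsilon> *\<^sub>R v \<in> newton_halfplane q R"
    "\<And>t. t \<ge> 0 \<Longrightarrow> (x, y) + t *\<^sub>R v \<in> newton_halfplane q R"
  proof (cases "x > 0")
    case True
    \<comment> \<open>Moving left stays in the region until the axis \<open>x = 0\<close> or the
      line is met. Points already on that axis are treated with a vertical ray.\<close>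
    define \<epsilon> where "\<epsilon> = min x (x + q * y - q * R)"
    show ?thesis
      by (rule that[of "(1, 0)" \<epsilon>]) (use True gt xy in \<open>auto simp: \<epsilon>_def newton_halfplane_def\<close>)
  next
    case False
    then have "q * y > q * R" using gt xy by simp
    then have "y > R" using q by simp
    have "q * (y + t) \<ge> q * R" if "t \<ge> 0" for t
      using that q \<open>y > R\<close> by simp
    then show ?thesis
      by (intro that[of "(0, 1)" "y - R"])
        (use \<open>y > R\<close> xy R in \<open>auto simp: newton_halfplane_def intro: add_increasing\<close>)
  qed
  have ray: "(x, y) + t *\<^sub>R v \<in> E" if "t > 0" for t
  proof -
    have "v \<noteq> 0" using v(1) by auto
    define s where "s = \<epsilon> / (\<epsilon> + t)"
    have s: "0 < s" "s < 1" using v(2) that by (auto simp: s_def field_simps)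
    have "s * t = (1 - s) * \<epsilon>" using v(2) that by (simp add: s_def field_simps)
    moreover have "(1 - s) * (z - \<epsilon> * u) + s * (z + t * u) = z + u * (s * t - (1 - s) * \<epsilon>)" for z u
      by (simp add: algebra_simps)
    ultimately have "(x, y) = (1 - s) *\<^sub>R ((x, y) - \<epsilon> *\<^sub>R v) + s *\<^sub>R ((x, y) + t *\<^sub>R v)"
      by (cases v) simp
    moreover have "(x, y) - \<epsilon> *\<^sub>R v \<noteq> (x, y) + t *\<^sub>R v"
    proof
      assume "(x, y) - \<epsilon> *\<^sub>R v = (x, y) + t *\<^sub>R v"
      then have "(\<epsilon> + t) *\<^sub>R v = 0" by (auto simp: scaleR_add_left add_eq_0_iff)
      then show False using \<open>v \<noteq> 0\<close> v(2) that by simp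
    qed
    ultimately have "(x, y) \<in> open_segment ((x, y) - \<epsilon> *\<^sub>R v) ((x, y) + t *\<^sub>R v)"
      using s by (auto simp: in_segment)
    then show ?thesis using face_ofD[OF E(1) _ v(3) v(4)[of t] z] that by simp
  qed
  obtain K where K: "\<And>w. w \<in> E \<Longrightarrow> norm w \<le> K" "K > 0"
    using compact_imp_bounded[OF E(2)] bounded_pos by metis
  \<comment> \<open>At this parameter the point of the ray has norm at least \<open>K + 1\<close>,
    beyond the bound \<open>K\<close> for \<open>E\<close>.\<close>
  define t where "t = K + norm (x, y) + 1"
  have "t > 0" using K(2) by (simp add: t_def add_pos_nonneg)
  have "t = norm (t *\<^sub>R v)" using v(1) \<open>t > 0\<close> by simp
  also have "\<dots> = norm (((x, y) + t *\<^sub>R v) - (x, y))" by simp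
  also have "\<dots> \<le> norm ((x, y) + t *\<^sub>R v) + norm (x, y)" by (rule norm_triangle_ineq4)
  finally show False using K(1)[OF ray[OF \<open>t > 0\<close>]] by (simp add: t_def)
qed

text \<open>The line supports the convex region and so cuts out a face; this face is a segment,
  hence compact and one-dimensional.\<close>

lemma edge_newton_halfplane:
  assumes q: "q > 0" and R: "R > 0"
  defines "E \<equiv> {(x, y). x \<ge> 0 \<and> y \<ge> 0 \<and> x + q * y = q * R}"
  shows "E edge_of newton_halfplane q R" "compact E"
proof -
  have "E = newton_halfplane q R \<inter> {z. (1, q) \<bullet> z = q * R}"
    by (auto simp: E_def newton_halfplane_def)
  moreover have "\<dots> face_of newton_halfplane q R"
    by (rule face_of_Int_supporting_hyperplane_ge[OF convex_newton_halfplane])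
      (auto simp: newton_halfplane_def)
  ultimately have face: "E face_of newton_halfplane q R" by simp
  have seg: "E = closed_segment (0, R) (q * R, 0)"
  proof
    show "E \<subseteq> closed_segment (0, R) (q * R, 0)"
    proof
      fix z assume "z \<in> E"
      then obtain x y where z: "z = (x, y)" and xy: "x \<ge> 0" "y \<ge> 0" "x + q * y = q * R"
        by (auto simp: E_def)
      define u where "u = x / (q * R)"
      have "q * y \<ge> 0" using xy q by simp
      then have "x \<le> q * R" using xy by simp
      then have u: "u \<ge> 0" "u \<le> 1" using q R xy by (auto simp: u_def)
      have "q * (R - x / q) = q * R - x" using q by (simp add: right_diff_distrib)
      then have "q * y = q * (R - x / q)" using xy by simp
      then have "y = R - x / q" using q by simp
      moreover have "u * R = x / q" "u * (q * R) = x" using q R by (simp_all add: u_def)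
      ultimately have "z = (1 - u) *\<^sub>R (0, R) + u *\<^sub>R (q * R, 0)"
        by (simp add: z left_diff_distrib)
      with u show "z \<in> closed_segment (0, R) (q * R, 0)" by (auto simp: in_segment)
    qed
    have "closed_segment (0, R) (q * R, 0) \<subseteq> E"
    proof (rule closed_segment_subset)
      show "convex E" using face face_of_imp_convex by blast
    qed (use q R in \<open>auto simp: E_def\<close>)
    then show "closed_segment (0, R) (q * R, 0) \<subseteq> E" .
  qed
  then show "compact E" by simp
  have "aff_dim E = 1" unfolding seg segment_convex_hull aff_dim_convex_hull aff_dim_2 using R by simp
  then show "E edge_of newton_halfplane q R" using face by (simp add: edge_of_def)
qed

lemma newton_initial_nth:
  assumes q: "q > 0" and R: "R > 0"
    and ge: "\<And>i j. bcoeff G i j \<noteq> 0 \<Longrightarrow> real i + q * real j \<ge> q * real R"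
    and end1: "bcoeff G 0 R \<noteq> 0" and end2: "real i0 = q * real R" "bcoeff G i0 0 \<noteq> 0"
  shows "bcoeff (newton_initial G) i j = (if real i + q * real j = q * real R then bcoeff G i j else 0)"
proof -
  have nd: "newton_diagram G = newton_halfplane q R" by (rule newton_diagram_eq[OF assms])
  have "(\<exists>E. E edge_of newton_diagram G \<and> compact E \<and> (real i, real j) \<in> E) \<longleftrightarrow>
      real i + q * real j = q * real R"
  proof
    assume "real i + q * real j = q * real R"
    then show "\<exists>E. E edge_of newton_diagram G \<and> compact E \<and> (real i, real j) \<in> E"
      unfolding nd using edge_newton_halfplane[OF q, of "real R"] R
      by (intro exI conjI) (auto simp: R)
  next
    assume "\<exists>E. E edge_of newton_diagram G \<and> compact E \<and> (real i, real j) \<in> E"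
    then show "real i + q * real j = q * real R"
      unfolding nd edge_of_def using compact_face_newton_halfplane[OF q] R of_nat_0_less_iff by blast
  qed
  then show ?thesis by (simp add: newton_initial_def bcoeff_def)
qed

subsection \<open>Roots of unity\<close>

text \<open>Both sides are monic of degree \<open>n\<close>, and for \<open>c \<noteq> 0\<close>
  they vanish at the same \<open>n\<close> distinct points. For \<open>c = 0\<close> the points
  coincide and both sides are \<open>monom 1 n\<close>.\<close>

lemma prod_primitive_root:
  fixes c \<eta> :: complex
  assumes "n > 0" and \<eta>: "\<And>k. \<eta> ^ k = 1 \<longleftrightarrow> n dvd k"
  shows "(\<Prod>i<n. [:- (\<eta> ^ i * c), 1:]) = monom 1 n - [:c ^ n:]"
proof (cases "c = 0")
  case True
  then show ?thesis using assms(1) by (simp add: monom_altdef power_0_left)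
next
  case False
  have deg: "degree (monom 1 n - [:c ^ n:]) \<le> n"
    by (intro degree_diff_le) (auto simp: degree_monom_le)
  have "\<eta> \<noteq> 0" using \<eta>[of n] assms(1) by (auto simp: power_0_left)
  have inj: "inj_on (\<lambda>i. \<eta> ^ i * c) {..<n}"
  proof (rule linorder_inj_onI)
    fix i j assume ij: "i < j" "i \<in> {..<n}" "j \<in> {..<n}"
    have "\<eta> ^ (j - i) \<noteq> 1" using \<eta>[of "j - i"] ij by (auto dest: dvd_imp_le)
    then have "\<eta> ^ i * \<eta> ^ (j - i) \<noteq> \<eta> ^ i" using \<open>\<eta> \<noteq> 0\<close> by simp
    then show "\<eta> ^ i * c \<noteq> \<eta> ^ j * c" using ij False by (simp flip: power_add)
  qed auto
  show ?thesis
  proof (rule poly_eqI_degree_lead_coeff[where n = n and A = "(\<lambda>i. \<eta> ^ i * c) ` {..<n}"])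
    have "degree (\<Prod>i<n. [:- (\<eta> ^ i * c), 1:]) = n"
      using degree_prod_mset_linear[of "\<lambda>i. \<eta> ^ i * c" "mset_set {..<n}"]
      by (simp add: prod_unfold_prod_mset)
    moreover have "lead_coeff (\<Prod>i<n. [:- (\<eta> ^ i * c), 1:]) = 1" by (simp add: lead_coeff_prod)
    ultimately show "coeff (\<Prod>i<n. [:- (\<eta> ^ i * c), 1:]) n = coeff (monom 1 n - [:c ^ n:]) n"
      "degree (\<Prod>i<n. [:- (\<eta> ^ i * c), 1:]) \<le> n"
      using assms(1) by (auto simp: coeff_pCons split: nat.splits)
    show "card ((\<lambda>i. \<eta> ^ i * c) ` {..<n}) \<ge> n" using card_image[OF inj] by simp
    show "degree (monom 1 n - [:c ^ n:]) \<le> n" by (rule deg)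
    fix z assume "z \<in> (\<lambda>i. \<eta> ^ i * c) ` {..<n}"
    then obtain i where i: "i < n" "z = \<eta> ^ i * c" by auto
    have "(\<eta> ^ i) ^ n = 1" using \<eta>[of "i * n"] by (simp add: power_mult)
    then have "poly (monom 1 n - [:c ^ n:]) z = 0" by (simp add: i poly_monom power_mult_distrib)
    moreover have "poly (\<Prod>i<n. [:- (\<eta> ^ i * c), 1:]) z = 0"
      using i by (auto simp: poly_prod intro!: bexI[of _ i])
    ultimately show "poly (\<Prod>i<n. [:- (\<eta> ^ i * c), 1:]) z = poly (monom 1 n - [:c ^ n:]) z" by simp
  qed
qed

lemma proots_primitive_root:
  fixes c \<eta> :: complex
  assumes "n > 0" and \<eta>: "\<And>k. \<eta> ^ k = 1 \<longleftrightarrow> n dvd k"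
  shows "proots (monom 1 n - [:c ^ n:]) = image_mset (\<lambda>i. \<eta> ^ i * c) (mset_set {..<n})"
proof -
  have "(\<Prod>i<n. [:- (\<eta> ^ i * c), 1:]) \<noteq> 0" by simp
  then have "proots (\<Prod>i<n. [:- (\<eta> ^ i * c), 1:]) = (\<Sum>i<n. {#\<eta> ^ i * c#})"
    by (subst proots_prod) auto
  then show ?thesis unfolding prod_primitive_root[OF assms]
    by (simp add: sum_unfold_sum_mset)
qed

text \<open>\<open>M\<close> consecutive powers of \<zeta> exhaust the \<open>M\<close>-th roots of
  unity, so their factors multiply to \<open>v^M - a^M s^(Q M)\<close>, where
  \<open>s^(Q M) = s^(L D) = u^L\<close>. The powers have period \<open>M\<close>, so
  \<open>K\<close> factors form \<open>K div M\<close> such blocks.\<close>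

lemma prod_hfactor_primitive_root:
  assumes "M > 0" and \<zeta>: "\<And>k. \<zeta> ^ k = 1 \<longleftrightarrow> M dvd k" and "M dvd K" and "Q * M = L * D" "D > 0"
  shows "(\<Prod>k<K. hfactor Q (\<zeta> ^ k * a)) = ramify D (quasi_factor M L (a ^ M)) ^ (K div M)"
proof -
  have 0: "fps_nth (fps_X ^ D :: complex fps) 0 = 0" using assms by simp
  have one: "(\<Prod>k<M. hfactor Q (\<zeta> ^ k * a)) = ramify D (quasi_factor M L (a ^ M))"
  proof (rule fps_ext)
    fix j
    have "(\<Prod>k<M. hfactor Q (\<zeta> ^ k * a)) =
        (\<Prod>b\<in>#image_mset (\<lambda>k. \<zeta> ^ k * a) (mset_set {..<M}). hfactor Q b)"
      by (simp add: prod_unfold_prod_mset image_mset.compositionality comp_def)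
    also have "fps_nth \<dots> j = fps_const (coeff (monom 1 M - [:a ^ M:]) j) * fps_X ^ ((M - j) * Q)"
      unfolding prod_mset_hfactor_nth prod_primitive_root[OF assms(1) \<zeta>, symmetric]
      by (simp add: prod_unfold_prod_mset image_mset.compositionality comp_def)
    also have "\<dots> = fps_nth (fps_X ^ M - fps_const (fps_const (a ^ M) * fps_X ^ (L * D))) j"
      using assms(1) \<open>Q * M = L * D\<close>
      by (auto simp: coeff_pCons mult.commute[of _ Q] split: nat.splits)
    also have "fps_X ^ M - fps_const (fps_const (a ^ M) * fps_X ^ (L * D)) =
        ramify D (quasi_factor M L (a ^ M))"
      unfolding quasi_factor_def ramify_eq_comp_fst
      by (simp add: comp_fst_diff comp_fst_power[OF 0] fps_compose_mult_distrib[OF 0]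
          fps_X_power_compose[OF \<open>D > 0\<close>])
    finally show "fps_nth (\<Prod>k<M. hfactor Q (\<zeta> ^ k * a)) j =
      fps_nth (ramify D (quasi_factor M L (a ^ M))) j" .
  qed
  obtain l where l: "K = l * M" using \<open>M dvd K\<close> by (metis dvd_div_mult_self)
  have "\<zeta> ^ M = 1" using \<zeta>[of M] by simp
  then have per: "\<zeta> ^ (k + i * M) = \<zeta> ^ k" for k i
    by (simp add: power_add power_mult mult.commute[of i])
  have "(\<Prod>k<l * M. hfactor Q (\<zeta> ^ k * a)) =
      (\<Prod>i<l. \<Prod>k=i * M..<i * M + M. hfactor Q (\<zeta> ^ k * a))"
    by (rule prod.nat_group[symmetric])
  also have "\<dots> = (\<Prod>i<l. \<Prod>k<M. hfactor Q (\<zeta> ^ (k + i * M) * a))"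
  proof (rule prod.cong[OF refl])
    fix i
    show "(\<Prod>k=i * M..<i * M + M. hfactor Q (\<zeta> ^ k * a)) =
        (\<Prod>k<M. hfactor Q (\<zeta> ^ (k + i * M) * a))"
      by (rule prod.reindex_bij_witness[of _ "\<lambda>k. k + i * M" "\<lambda>k. k - i * M"]) auto
  qed
  also have "\<dots> = (\<Prod>k<M. hfactor Q (\<zeta> ^ k * a)) ^ l" unfolding per by simp
  finally have "(\<Prod>k<l * M. hfactor Q (\<zeta> ^ k * a)) = (\<Prod>k<M. hfactor Q (\<zeta> ^ k * a)) ^ l" .
  then show ?thesis using one l assms(1) by simp
qed

subsection \<open>Critical points\<close>

lemma filter_mset_sum: "filter_mset P (\<Sum>a\<in>A. f a) = (\<Sum>a\<in>A. filter_mset P (f a))"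
  by (induction A rule: infinite_finite_induct) auto

lemma filter_mset_replicate:
  "filter_mset P (replicate_mset k x) = (if P x then replicate_mset k x else {#})"
  by (induction k) auto

text \<open>Differentiating \<open>H(z^n) = F(z)^M\<close> gives
  \<open>M F^(M-1) F' = n z^(n-1) H'(z^n)\<close>; root multisets are compared and roots of
  \<open>F\<close> discarded, which removes \<open>F^(M-1)\<close>. Since \<open>c^n = t j\<close>
  implies \<open>F(c)^M = H(t j)\<close>, the roots belonging to one \<open>t j\<close> are kept or
  dropped together.\<close>

lemma critical_points:
  fixes F H :: "complex poly" and t :: "nat \<Rightarrow> complex"
  assumes pos: "n > 0" "M > 0" and F': "pderiv F \<noteq> 0"
    and HB: "pcompose H (monom 1 n) = F ^ M"
    and HB': "pderiv H = smult C (\<Prod>j=1..r. [:- t j, 1:])"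
  shows "filter_mset (\<lambda>c. poly F c \<noteq> 0) (proots (pderiv F)) =
    replicate_mset (if poly H 0 \<noteq> 0 then n - 1 else 0) 0 +
    (\<Sum>j\<in>{j\<in>{1..r}. poly H (t j) \<noteq> 0}. proots (monom 1 n - [:t j:]))"
proof -
  let ?P = "\<lambda>c. poly F c \<noteq> 0"
  have val: "poly F c ^ M = poly H (c ^ n)" for c
    using arg_cong[OF HB, of "\<lambda>p. poly p c"] by (simp add: poly_pcompose poly_monom)
  have "F \<noteq> 0" using F' by auto
  have nz: "monom 1 n - [:a:] \<noteq> 0" for a :: complex
  proof -
    have "coeff (monom 1 n - [:a:]) n = 1" using pos(1) by (simp add: coeff_pCons split: nat.splits)
    then show ?thesis by (metis coeff_0 one_neq_zero)
  qed
  have "smult (of_nat M) (F ^ (M - 1)) * pderiv F = pderiv (F ^ M)"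
    using pderiv_power[of F M] by simp
  also have "\<dots> = pcompose (pderiv H) (monom 1 n) * monom (of_nat n) (n - 1)"
    by (simp add: HB[symmetric] pderiv_pcompose pderiv_monom)
  also have "pcompose (pderiv H) (monom 1 n) = smult C (\<Prod>j=1..r. monom 1 n - [:t j:])"
    by (simp add: HB' pcompose_smult pcompose_prod pcompose_pCons diff_conv_add_uminus add.commute)
  finally have eq: "smult (of_nat M) (F ^ (M - 1)) * pderiv F =
    smult C (\<Prod>j=1..r. monom 1 n - [:t j:]) * monom (of_nat n) (n - 1)" .
  have lhs: "smult (of_nat M) (F ^ (M - 1)) * pderiv F \<noteq> 0"
    using F' \<open>F \<noteq> 0\<close> pos by simp
  then have "C \<noteq> 0" using eq by auto
  have "proots (monom (of_nat n) (n - 1) :: complex poly) = replicate_mset (n - 1) 0"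
    using pos by (simp add: monom_altdef proots_power)
  moreover have "(\<Prod>j=1..r. monom 1 n - [:t j:]) \<noteq> 0"
    using nz by simp
  moreover have "monom (of_nat n) (n - 1) \<noteq> (0 :: complex poly)"
    using pos by (simp add: monom_eq_0_iff)
  moreover have "proots (\<Prod>j=1..r. monom 1 n - [:t j:]) = (\<Sum>j=1..r. proots (monom 1 n - [:t j:]))"
    by (rule proots_prod) (use nz in auto)
  ultimately have
    "proots (smult C (\<Prod>j=1..r. monom 1 n - [:t j:]) * monom (of_nat n) (n - 1)) =
     (\<Sum>j=1..r. proots (monom 1 n - [:t j:])) + replicate_mset (n - 1) 0"
    using \<open>C \<noteq> 0\<close> by (simp add: proots_mult del: mult_smult_left)
  moreover have "proots (smult (of_nat M) (F ^ (M - 1)) * pderiv F) =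
      repeat_mset (M - 1) (proots F) + proots (pderiv F)"
    using pos F' \<open>F \<noteq> 0\<close> by (simp add: proots_mult proots_power del: mult_smult_left)
  ultimately have "repeat_mset (M - 1) (proots F) + proots (pderiv F) =
     (\<Sum>j=1..r. proots (monom 1 n - [:t j:])) + replicate_mset (n - 1) 0"
    using eq by simp
  then have "filter_mset ?P (repeat_mset (M - 1) (proots F)) + filter_mset ?P (proots (pderiv F)) =
     (\<Sum>j=1..r. filter_mset ?P (proots (monom 1 n - [:t j:]))) + filter_mset ?P (replicate_mset (n - 1) 0)"
    by (metis filter_mset_sum filter_union_mset)
  moreover have "filter_mset ?P (repeat_mset (M - 1) (proots F)) = {#}"
    using \<open>F \<noteq> 0\<close> by (auto simp: order_root simp flip: count_greater_zero_iff)
  moreover have "filter_mset ?P (replicate_mset (n - 1) 0) =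
      replicate_mset (if poly H 0 \<noteq> 0 then n - 1 else 0) 0"
    using val[of 0] pos by (auto simp: power_0_left filter_mset_replicate)
  moreover have "filter_mset ?P (proots (monom 1 n - [:a:])) =
      (if poly H a \<noteq> 0 then proots (monom 1 n - [:a:]) else {#})" for a
  proof -
    have "?P c \<longleftrightarrow> poly H a \<noteq> 0" if "c \<in># proots (monom 1 n - [:a:])" for c
    proof -
      have "c ^ n = a" using that nz by (simp add: poly_monom)
      then show ?thesis using val[of c] pos by (metis power_eq_0_iff)
    qed
    then have "filter_mset ?P (proots (monom 1 n - [:a:])) =
        filter_mset (\<lambda>_. poly H a \<noteq> 0) (proots (monom 1 n - [:a:]))"
      by (intro filter_mset_cong) auto
    then show ?thesis by simp
  qed
  ultimately show ?thesis
    by (simp add: sum.inter_filter[symmetric] add.commute del: filter_mset_eq_mempty_iff)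
qed

text \<open>At a root of \<open>F\<close> the order of \<open>F'\<close> is one less. If every root
  of \<open>F'\<close> were a root of \<open>F\<close>, summing orders would give
  \<open>degree F = degree F - 1 + card Z\<close>, so \<open>F\<close> would have a single
  root.\<close>

lemma critical_point_off_roots:
  fixes F :: "complex poly"
  assumes roots: "poly F c = 0" "poly F c' = 0" "c \<noteq> c'" and "F \<noteq> 0"
  shows "filter_mset (\<lambda>c. poly F c \<noteq> 0) (proots (pderiv F)) \<noteq> {#}"
proof
  assume *: "filter_mset (\<lambda>c. poly F c \<noteq> 0) (proots (pderiv F)) = {#}"
  define Z where "Z = {z. poly F z = 0}"
  have fin: "finite Z" unfolding Z_def using \<open>F \<noteq> 0\<close> by (rule poly_roots_finite)
  have deg: "degree F > 0"
    using roots(1) \<open>F \<noteq> 0\<close> by (metis gr0I degree_eq_zeroE poly_const_conv pCons_eq_0_iff)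
  then have F': "pderiv F \<noteq> 0" by (simp add: pderiv_eq_0_iff)
  have "degree F = (\<Sum>z\<in>Z. order z F)"
    unfolding size_proots_complex[symmetric] size_multiset_overloaded_eq
    using \<open>F \<noteq> 0\<close> by (simp add: Z_def)
  also have "\<dots> = (\<Sum>z\<in>Z. Suc (order z (pderiv F)))"
  proof (rule sum.cong[OF refl])
    fix z assume "z \<in> Z"
    then show "order z F = Suc (order z (pderiv F))"
      using order_pderiv[OF \<open>F \<noteq> 0\<close>] by (simp add: Z_def)
  qed
  also have "\<dots> = (\<Sum>z\<in>Z. count (proots (pderiv F)) z) + card Z"
    using F' by (simp add: sum_Suc)
  also have "(\<Sum>z\<in>Z. count (proots (pderiv F)) z) = size (proots (pderiv F))"
    unfolding size_multiset_overloaded_eq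
    using * fin by (intro sum.mono_neutral_right)
      (auto simp: Z_def not_in_iff simp del: count_proots set_count_proots)
  also have "size (proots (pderiv F)) = degree F - 1"
    by (simp add: size_proots_complex degree_pderiv)
  finally have "card Z = 1" using deg by simp
  then obtain z where "Z = {z}" by (auto simp: card_1_singleton_iff)
  moreover have "c \<in> Z" "c' \<in> Z" using roots by (simp_all add: Z_def)
  ultimately show False using roots(3) by (metis singletonD)
qed

subsection \<open>Descending from the root variable\<close>

lemma bcoeff_ramify:
  assumes "D > 0"
  shows "fps_nth (fps_nth (ramify D G) j) k = (if D dvd k then bcoeff G (k div D) j else 0)"
  by (simp add: ramify_eq_comp_fst fps_compose_X_power_nth[OF assms] bcoeff_def)

lemma bseries_eqI: "(\<And>i j. bcoeff G i j = bcoeff G' i j) \<Longrightarrow> G = G'"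
  by (simp add: bcoeff_def fps_eq_iff[where 'a="complex fps"] fps_eq_iff)

lemma bcoeff_ramify_mult:
  assumes "D > 0"
  shows "bcoeff G i j = fps_nth (fps_nth (ramify D G) j) (D * i)"
  using assms by (simp add: bcoeff_ramify)

lemma ramify_inject:
  assumes "D > 0" "ramify D G = ramify D G'"
  shows "G = G'"
  by (rule bseries_eqI) (simp add: bcoeff_ramify_mult[OF assms(1)] assms(2))

text \<open>Invariance under \<omega> multiplies the coefficient of \<open>s^k\<close> by
  \<open>\<omega> ^ k\<close> without changing it, so only exponents divisible by \<open>D\<close>
  survive.\<close>

lemma ramify_exists:
  assumes "D > 0" and \<omega>: "\<And>k. \<omega> ^ k = 1 \<longleftrightarrow> D dvd k"
    and W: "comp_fst (fps_const \<omega> * fps_X) W = W"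
  shows "\<exists>G. ramify D G = W"
proof
  have zero: "fps_nth (fps_nth W j) k = 0" if "\<not> D dvd k" for j k
  proof -
    have "fps_nth (fps_nth W j) k = fps_nth (fps_nth (comp_fst (fps_const \<omega> * fps_X) W) j) k"
      by (simp only: W)
    also have "\<dots> = \<omega> ^ k * fps_nth (fps_nth W j) k" by (simp add: rot_nth)
    finally show ?thesis using that \<omega>[of k] by simp
  qed
  show "ramify D (Abs_fps (\<lambda>j. Abs_fps (\<lambda>i. fps_nth (fps_nth W j) (D * i)))) = W"
    using zero assms(1) by (auto simp: fps_eq_iff[where 'a="complex fps"] fps_eq_iff bcoeff_ramify bcoeff_def)
qed

text \<open>In \<open>s, v\<close> all monomials lie on or above the line through
  \<open>(0, R)\<close> and \<open>(R Q, 0)\<close>; passing to \<open>u = s^D\<close> divides the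
  first coordinate by \<open>D\<close>. As no leading coefficient vanishes, both end points occur,
  and the terms on the line are the product of the leading forms.\<close>

lemma newton_initial_ramified:
  assumes D: "D > 0" and Q: "Q > 0" and "A \<noteq> {#}"
    and A: "\<And>b. b \<in># A \<Longrightarrow> lead b Q (fps_nth b Q) \<and> fps_nth b Q \<noteq> 0"
    and G: "ramify D G = (\<Prod>b\<in>#A. fps_X - fps_const b)"
    and G0: "ramify D G0 = (\<Prod>b\<in>#A. hfactor Q (fps_nth b Q))"
  shows "newton_initial G = G0"
proof (rule bseries_eqI)
  define R where "R = size A"
  define P where "P = (\<Prod>b\<in>#A. [:- fps_nth b Q, 1:])"
  define q where "q = real Q / real D"
  have q: "q > 0" and R: "R > 0" using D Q \<open>A \<noteq> {#}\<close> by (auto simp: q_def R_def nonempty_has_size)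
  have degP: "degree P = R" unfolding P_def R_def by (rule degree_prod_mset_linear)
  have lc: "coeff P R = 1"
  proof -
    have "lead_coeff P = 1" unfolding P_def
      by (induction A) (simp_all add: lead_coeff_mult del: mult_pCons_left)
    then show ?thesis by (simp add: degP)
  qed
  have tc: "coeff P 0 \<noteq> 0"
  proof -
    have "poly P 0 \<noteq> 0" using A unfolding P_def by (induction A) auto
    then show ?thesis by (simp add: poly_0_coeff_0)
  qed
  have W1: "lead (fps_nth (ramify D G) j) ((R - j) * Q) (coeff P j)" if "j \<le> R" for j
    using lead_prod_mset_linear[of A Q j] A that unfolding G R_def P_def by blast
  have W2: "fps_nth (ramify D G) j = 0" if "j > R" for j
    using lead_prod_mset_linear[of A Q j] A that unfolding G R_def P_def by blast
  have W0: "fps_nth (ramify D G0) j = fps_const (coeff P j) * fps_X ^ ((R - j) * Q)" for j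
    using prod_mset_hfactor_nth[of Q "image_mset (\<lambda>b. fps_nth b Q) A" j]
    by (simp add: G0 P_def R_def image_mset.compositionality comp_def)
  have line: "real i + q * real j = q * real R \<longleftrightarrow> D * i + Q * j = Q * R" for i j
  proof -
    have "real i + q * real j = q * real R \<longleftrightarrow> real (D * i + Q * j) = real (Q * R)"
      using D by (simp add: q_def field_simps)
    then show ?thesis by (simp only: of_nat_eq_iff)
  qed
  fix i j
  have ge: "real i + q * real j \<ge> q * real R" if "bcoeff G i j \<noteq> 0" for i j
  proof (cases "j \<le> R")
    case True
    then have "D * i \<ge> (R - j) * Q"
      using W1[OF True] that by (auto simp: bcoeff_ramify_mult[OF D] lead_def not_le[symmetric])
    then have "D * i + Q * j \<ge> Q * R" using True by (simp add: algebra_simps)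
    then have "real (D * i + Q * j) \<ge> real (Q * R)" by (simp only: of_nat_le_iff)
    then show ?thesis using D by (simp add: q_def field_simps)
  next
    case False
    then show ?thesis using W2[of j] that by (simp add: bcoeff_ramify_mult[OF D])
  qed
  have end1: "bcoeff G 0 R \<noteq> 0" using W1[of R] lc by (simp add: bcoeff_ramify_mult[OF D] lead_def)
  \<comment> \<open>A ramified series has only exponents divisible by \<open>D\<close>, so this
    nonzero coefficient makes the end point on the \<open>u\<close>-axis integral.\<close>
  have *: "fps_nth (fps_nth (ramify D G) 0) (R * Q) \<noteq> 0" using W1[of 0] tc by (simp add: lead_def)
  then have "D dvd R * Q" by (auto simp: bcoeff_ramify[OF D] split: if_splits)
  then obtain i0 where i0: "R * Q = D * i0" by auto
  have end2: "real i0 = q * real R" using line[of i0 0] i0 by (simp add: mult.commute)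
  have end2': "bcoeff G i0 0 \<noteq> 0" using * i0 by (simp add: bcoeff_ramify_mult[OF D])
  have "bcoeff (newton_initial G) i j = (if D * i + Q * j = Q * R then bcoeff G i j else 0)"
    using newton_initial_nth[OF q R ge end1 end2 end2'] line by simp
  also have "\<dots> = bcoeff G0 i j"
  proof (cases "D * i + Q * j = Q * R")
    case True
    then have "Q * j \<le> Q * R" by (metis le_add2)
    then have jR: "j \<le> R" using Q by simp
    then have "D * i = (R - j) * Q" using True by (simp add: algebra_simps)
    then show ?thesis using W1[OF jR] True by (simp add: bcoeff_ramify_mult[OF D] W0 lead_def)
  next
    case False
    have "bcoeff G0 i j = 0"
    proof (cases "j \<le> R")
      case True
      then have "D * i \<noteq> (R - j) * Q" using False by (auto simp: algebra_simps)
      then show ?thesis by (simp add: bcoeff_ramify_mult[OF D] W0 fps_X_power_nth)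
    next
      case jR: False
      then show ?thesis by (simp add: bcoeff_ramify_mult[OF D] W0 coeff_eq_0 degP)
    qed
    then show ?thesis using False by simp
  qed
  finally show "bcoeff (newton_initial G) i j = bcoeff G0 i j" .
qed

subsection \<open>Products over a conjugacy orbit\<close>

text \<open>Conjugation commutes with substitution into the invariant series
  \<open>ramify D f\<close> and permutes \<Gamma>, carrying the members selected by \<open>P\<close>
  to those selected by \<open>P'\<close>.\<close>

lemma comp_fst_linear_product:
  assumes D: "D > 0" and \<omega>: "\<omega> ^ D = 1" and \<Gamma>: "image_mset (rot \<omega>) \<Gamma> = \<Gamma>"
    and \<Gamma>0: "\<And>g. g \<in># \<Gamma> \<Longrightarrow> fps_nth g 0 = 0"
    and P: "\<And>g. g \<in># \<Gamma> \<Longrightarrow> P' (rot \<omega> g) \<longleftrightarrow> P g"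
  shows "comp_fst (fps_const \<omega> * fps_X)
      (\<Prod>g\<in>#filter_mset P \<Gamma>. fps_X - fps_const (subst_snd (ramify D f) g)) =
    (\<Prod>g\<in>#filter_mset P' \<Gamma>. fps_X - fps_const (subst_snd (ramify D f) g))"
proof -
  have 0: "fps_nth (fps_const \<omega> * fps_X) 0 = 0" by simp
  have \<phi>: "rot \<omega> (subst_snd (ramify D f) g) = subst_snd (ramify D f) (rot \<omega> g)" if "g \<in># \<Gamma>" for g
    using subst_snd_compose[OF 0 \<Gamma>0[OF that], of "ramify D f"] by (simp add: rot_ramify[OF \<omega> D])
  have "filter_mset P' \<Gamma> = filter_mset P' (image_mset (rot \<omega>) \<Gamma>)" by (simp only: \<Gamma>)
  also have "\<dots> = image_mset (rot \<omega>) (filter_mset (\<lambda>g. P' (rot \<omega> g)) \<Gamma>)"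
    by (simp add: filter_mset_image_mset)
  also have "filter_mset (\<lambda>g. P' (rot \<omega> g)) \<Gamma> = filter_mset P \<Gamma>"
    by (rule filter_mset_cong) (simp_all add: P)
  finally have "filter_mset P' \<Gamma> = image_mset (rot \<omega>) (filter_mset P \<Gamma>)" .
  then have "(\<Prod>g\<in>#filter_mset P' \<Gamma>. fps_X - fps_const (subst_snd (ramify D f) g)) =
      (\<Prod>g\<in>#filter_mset P \<Gamma>. fps_X - fps_const (subst_snd (ramify D f) (rot \<omega> g)))"
    by (simp add: image_mset.compositionality comp_def)
  also have "\<dots> = (\<Prod>g\<in>#filter_mset P \<Gamma>. fps_X - fps_const (rot \<omega> (subst_snd (ramify D f) g)))"
    by (intro arg_cong[where f = prod_mset] image_mset_cong) (simp add: \<phi>)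
  finally show ?thesis by (simp add: comp_fst_prod_mset[OF 0] comp_fst_diff)
qed

lemma prod_mset_image_sum:
  "(\<Prod>c\<in>#(\<Sum>j\<in>J. A j). g c) = (\<Prod>j\<in>J. \<Prod>c\<in>#A j. (g c :: 'b::comm_monoid_mult))"
  by (induction J rule: infinite_finite_induct) auto

text \<open>\<open>G c\<close> collects the \<open>N\<close> conjugate factors of one critical
  point. For \<open>c = 0\<close> with \<open>F(0) \<noteq> 0\<close> these suffice, since
  \<open>M\<close> divides \<open>N\<close>; the \<open>n\<close> solutions of
  \<open>c^n = t j\<close> are grouped into one run of \<open>n * N\<close> factors.\<close>

lemma orbit_hfactor_product:
  fixes F H :: "complex poly" and t :: "nat \<Rightarrow> complex" and \<omega> :: complex
  assumes pos: "D > 0" "n > 0" "M > 0" and QM: "Q * M = L * D"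
    and \<zeta>: "\<And>k. \<omega> ^ (Q * k) = 1 \<longleftrightarrow> M dvd k"
    and \<eta>: "\<And>k. \<omega> ^ (N * e * k) = 1 \<longleftrightarrow> n dvd k"
    and equiv: "\<And>c. poly F (\<omega> ^ (N * e) * c) = \<omega> ^ (N * Q) * poly F c"
    and F': "pderiv F \<noteq> 0"
    and HB: "pcompose H (monom 1 n) = F ^ M"
    and HB': "pderiv H = smult C (\<Prod>j=1..r. [:- t j, 1:])"
    and MnN: "M dvd n * N" and MN: "poly F 0 \<noteq> 0 \<Longrightarrow> M dvd N"
  defines "J \<equiv> {j\<in>{1..r}. poly H (t j) \<noteq> 0}"
  shows "(\<Prod>k<N. \<Prod>c\<in>#filter_mset (\<lambda>c. poly F c \<noteq> 0) (proots (pderiv F)).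
            hfactor Q (\<omega> ^ (k * Q) * poly F c)) =
    ramify D (if poly H 0 \<noteq> 0
      then quasi_factor M L (poly H 0) ^ ((n - 1) * N div M) *
        (\<Prod>j\<in>J. quasi_factor M L (poly H (t j)) ^ (n * N div M))
      else (\<Prod>j\<in>J. quasi_factor M L (poly H (t j)) ^ (n * N div M)))"
proof -
  define G where "G = (\<lambda>c. \<Prod>k<N. hfactor Q ((\<omega> ^ Q) ^ k * poly F c))"
  have 0: "fps_nth (fps_X ^ D :: complex fps) 0 = 0" using pos by simp
  have val: "poly F c ^ M = poly H (c ^ n)" for c
    using arg_cong[OF HB, of "\<lambda>p. poly p c"] by (simp add: poly_pcompose poly_monom)
  have \<zeta>': "(\<omega> ^ Q) ^ k = 1 \<longleftrightarrow> M dvd k" for k using \<zeta> by (simp add: power_mult)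
  have \<eta>': "(\<omega> ^ (N * e)) ^ k = 1 \<longleftrightarrow> n dvd k" for k using \<eta> by (simp add: power_mult)
  \<comment> \<open>Rotating \<open>c\<close> by \<open>\<omega> ^ (N * e)\<close> advances the
    exponent of \<open>\<omega> ^ Q\<close> by \<open>N\<close>. The blocks belonging to the
    \<open>n\<close> rotated points are thus consecutive.\<close>
  have equiv': "poly F ((\<omega> ^ (N * e)) ^ i * c) = (\<omega> ^ Q) ^ (i * N) * poly F c" for i c
  proof (induction i)
    case (Suc i)
    have "poly F ((\<omega> ^ (N * e)) ^ Suc i * c) = poly F (\<omega> ^ (N * e) * ((\<omega> ^ (N * e)) ^ i * c))"
      by (simp add: mult.assoc)
    also have "\<dots> = \<omega> ^ (N * Q) * ((\<omega> ^ Q) ^ (i * N) * poly F c)" by (simp only: equiv Suc)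
    also have "\<dots> = (\<omega> ^ Q) ^ (Suc i * N) * poly F c"
      by (simp add: power_add mult.commute[of N] power_mult mult.assoc)
    finally show ?case .
  qed simp
  have G0: "G 0 ^ (n - 1) = ramify D (quasi_factor M L (poly H 0) ^ ((n - 1) * N div M))"
    if "poly H 0 \<noteq> 0"
  proof -
    have "poly F 0 ^ M = poly H 0" using val[of 0] pos by (simp add: power_0_left)
    moreover from this that have "M dvd N" using MN pos by (metis power_eq_0_iff)
    ultimately have "G 0 = ramify D (quasi_factor M L (poly H 0)) ^ (N div M)"
      unfolding G_def using prod_hfactor_primitive_root[OF pos(3) \<zeta>' _ QM pos(1), of N "poly F 0"] by simp
    moreover have "(N div M) * (n - 1) = (n - 1) * N div M"
      using \<open>M dvd N\<close> by (simp add: dvd_div_mult mult.commute)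
    ultimately show ?thesis
      by (simp add: ramify_eq_comp_fst comp_fst_power[OF 0] flip: power_mult)
  qed
  have Gt: "(\<Prod>c\<in>#proots (monom 1 n - [:x:]). G c) =
      ramify D (quasi_factor M L (poly H x) ^ (n * N div M))" for x
  proof -
    obtain c where c: "c ^ n = x" using exists_complex_root[of n x] pos by auto
    have "(\<Prod>c\<in>#proots (monom 1 n - [:x:]). G c) = (\<Prod>i<n. G ((\<omega> ^ (N * e)) ^ i * c))"
      unfolding c[symmetric] proots_primitive_root[OF pos(2) \<eta>']
      by (simp add: prod_unfold_prod_mset image_mset.compositionality comp_def)
    also have "\<dots> = (\<Prod>i<n. \<Prod>k=i * N..<i * N + N. hfactor Q ((\<omega> ^ Q) ^ k * poly F c))"
    proof (rule prod.cong[OF refl])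
      fix i
      show "G ((\<omega> ^ (N * e)) ^ i * c) = (\<Prod>k=i * N..<i * N + N. hfactor Q ((\<omega> ^ Q) ^ k * poly F c))"
        unfolding G_def equiv'
        by (rule prod.reindex_bij_witness[of _ "\<lambda>k. k - i * N" "\<lambda>k. k + i * N"])
          (auto simp: power_add mult_ac)
    qed
    also have "\<dots> = (\<Prod>k<n * N. hfactor Q ((\<omega> ^ Q) ^ k * poly F c))" by (rule prod.nat_group)
    also have "\<dots> = ramify D (quasi_factor M L (poly F c ^ M)) ^ (n * N div M)"
      by (rule prod_hfactor_primitive_root[OF pos(3) \<zeta>' MnN QM pos(1)])
    finally show ?thesis by (simp add: val c ramify_eq_comp_fst comp_fst_power[OF 0])
  qed
  have "(\<Prod>k<N. \<Prod>c\<in>#filter_mset (\<lambda>c. poly F c \<noteq> 0) (proots (pderiv F)).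
            hfactor Q (\<omega> ^ (k * Q) * poly F c)) =
      (\<Prod>c\<in>#filter_mset (\<lambda>c. poly F c \<noteq> 0) (proots (pderiv F)). G c)"
  proof -
    have "(\<Prod>k<N. \<Prod>c\<in>#S. g k c) = (\<Prod>c\<in>#S. \<Prod>k<N. g k c)"
      for S :: "complex multiset" and g :: "nat \<Rightarrow> complex \<Rightarrow> bseries"
      by (induction S) (simp_all add: prod.distrib)
    then show ?thesis by (simp add: G_def mult.commute[of _ Q] power_mult)
  qed
  also have "\<dots> = G 0 ^ (if poly H 0 \<noteq> 0 then n - 1 else 0) *
      (\<Prod>j\<in>J. \<Prod>c\<in>#proots (monom 1 n - [:t j:]). G c)"
    unfolding critical_points[OF pos(2,3) F' HB HB'] J_def
    by (simp add: prod_mset_image_sum del: mem_Collect_eq)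
  also have "\<dots> = ramify D (if poly H 0 \<noteq> 0
      then quasi_factor M L (poly H 0) ^ ((n - 1) * N div M) *
        (\<Prod>j\<in>J. quasi_factor M L (poly H (t j)) ^ (n * N div M))
      else (\<Prod>j\<in>J. quasi_factor M L (poly H (t j)) ^ (n * N div M)))"
    unfolding Gt using G0
    by (simp add: ramify_eq_comp_fst comp_fst_prod[OF 0] comp_fst_mult[OF 0])
  finally show ?thesis .
qed

subsection \<open>Puiseux series with bounded denominators\<close>

text \<open>The exponent condition of \<open>root_series\<close>, separated from convergence and
  phrased with a natural numerator to match the coefficients of \<open>to_root\<close>.\<close>

definition root_support :: "nat \<Rightarrow> puiseux \<Rightarrow> bool" where
  "root_support D \<alpha> \<longleftrightarrow> (\<forall>q. \<alpha> q \<noteq> 0 \<longrightarrow> (\<exists>k. q = of_nat k / of_nat D))"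

lemma root_support_iff:
  assumes "D > 0"
  shows "root_support D \<alpha> \<longleftrightarrow> (\<forall>q. \<alpha> q \<noteq> 0 \<longrightarrow> q \<ge> 0 \<and> q * of_nat D \<in> \<int>)"
proof -
  have "(\<exists>k. q = of_nat k / of_nat D) \<longleftrightarrow> q \<ge> 0 \<and> q * of_nat D \<in> \<int>" for q :: rat
  proof
    assume q: "q \<ge> 0 \<and> q * of_nat D \<in> \<int>"
    then have "q * of_nat D \<in> \<nat>" by (simp add: Nats_altdef2)
    then obtain k where "q * of_nat D = of_nat k" by (auto elim: Nats_cases)
    then show "\<exists>k. q = of_nat k / of_nat D" using assms by (intro exI[of _ k]) (simp add: field_simps)
  qed (use assms in auto)
  then show ?thesis by (simp add: root_support_def)
qed

lemma root_series_iff: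
  "D > 0 \<Longrightarrow> \<alpha> \<in> root_series D \<longleftrightarrow> root_support D \<alpha> \<and> fps_conv_radius (to_root D \<alpha>) > 0"
  by (simp add: root_series_def root_support_iff)

lemma root_series_support: "D > 0 \<Longrightarrow> \<alpha> \<in> root_series D \<Longrightarrow> root_support D \<alpha>"
  by (simp add: root_series_iff)

lemma root_series_puiseux: "D > 0 \<Longrightarrow> \<alpha> \<in> root_series D \<Longrightarrow> \<alpha> \<in> puiseux_series"
  by (auto simp: puiseux_series_def)

lemma puiseux_series_support: "\<alpha> \<in> puiseux_series \<Longrightarrow> \<exists>D>0. root_support D \<alpha>"
  by (auto simp: puiseux_series_def root_series_iff)

lemma root_support_scale: "k > 0 \<Longrightarrow> root_support D \<alpha> \<Longrightarrow> root_support (k * D) \<alpha>"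
  unfolding root_support_def
proof (intro allI impI)
  fix q assume "k > 0" "\<forall>q. \<alpha> q \<noteq> 0 \<longrightarrow> (\<exists>k. q = of_nat k / of_nat D)" "\<alpha> q \<noteq> 0"
  moreover from this obtain j where "q = of_nat j / of_nat D" by auto
  ultimately show "\<exists>j. q = of_nat j / of_nat (k * D)" by (intro exI[of _ "k * j"]) simp
qed

lemma root_support_scale': "k > 0 \<Longrightarrow> root_support D \<alpha> \<Longrightarrow> root_support (D * k) \<alpha>"
  using root_support_scale[of k D] by (simp add: mult.commute)

lemma root_support_diff:
  "root_support D \<alpha> \<Longrightarrow> root_support D \<beta> \<Longrightarrow> root_support D (\<lambda>q. \<alpha> q - \<beta> q)"
  unfolding root_support_def by (metis diff_self)

lemma to_root_nth [simp]: "fps_nth (to_root D \<alpha>) k = \<alpha> (of_nat k / of_nat D)"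
  by (simp add: to_root_def)

lemma to_root_inject:
  assumes "root_support D \<alpha>" "root_support D \<beta>" "to_root D \<alpha> = to_root D \<beta>"
  shows "\<alpha> = \<beta>"
proof
  fix q
  have "\<alpha> (of_nat k / of_nat D) = \<beta> (of_nat k / of_nat D)" for k
    using arg_cong[OF assms(3), of "\<lambda>a. fps_nth a k"] by simp
  then show "\<alpha> q = \<beta> q" using assms(1,2) unfolding root_support_def by metis
qed

lemma of_nat_div_eq_iff:
  "D > 0 \<Longrightarrow> E > 0 \<Longrightarrow> (of_nat i / of_nat D = (of_nat j / of_nat E :: rat)) \<longleftrightarrow> i * E = j * D"
proof -
  assume "D > 0" "E > 0"
  then have "(of_nat i / of_nat D = (of_nat j / of_nat E :: rat)) \<longleftrightarrow>
      (of_nat (i * E) :: rat) = of_nat (j * D)" by (simp add: field_simps)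
  then show ?thesis by (simp only: of_nat_eq_iff)
qed

lemma to_root_scale:
  assumes "k > 0" "D > 0" "root_support D \<alpha>"
  shows "to_root (k * D) \<alpha> = fps_compose (to_root D \<alpha>) (fps_X ^ k)"
proof (rule fps_ext)
  fix m
  have "\<alpha> (of_nat m / of_nat (k * D)) = 0" if "\<not> k dvd m"
  proof (rule ccontr)
    assume "\<alpha> (of_nat m / of_nat (k * D)) \<noteq> 0"
    then obtain j where "of_nat m / of_nat (k * D) = (of_nat j / of_nat D :: rat)"
      using assms(3) unfolding root_support_def by blast
    then have "m * D = j * (k * D)" using assms of_nat_div_eq_iff[of "k * D" D m j] by simp
    then show False using that assms by auto
  qed
  then show "fps_nth (to_root (k * D) \<alpha>) m = fps_nth (fps_compose (to_root D \<alpha>) (fps_X ^ k)) m"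
    using assms by (auto simp: fps_compose_X_power_nth)
qed

lemma of_root_support:
  assumes "D > 0"
  shows "root_support D (of_root D a)"
  unfolding root_support_iff[OF assms] by (simp add: of_root_def)

lemma to_root_of_root:
  assumes "D > 0"
  shows "to_root D (of_root D a) = a"
  using assms by (simp add: fps_eq_iff of_root_def)

lemma ramify_scale:
  assumes "k > 0" "D > 0"
  shows "ramify (k * D) f = comp_fst (fps_X ^ k) (ramify D f)"
  using assms by (simp add: ramify_eq_comp_fst comp_fst_comp_fst fps_X_power_compose mult.commute)

lemma puiseux_index_props:
  assumes "D > 0" "\<alpha> \<in> root_series D"
  shows "puiseux_index \<alpha> > 0" "\<alpha> \<in> root_series (puiseux_index \<alpha>)" "puiseux_index \<alpha> \<le> D"
  using LeastI[of "\<lambda>N. N > 0 \<and> \<alpha> \<in> root_series N" D]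
    Least_le[of "\<lambda>N. N > 0 \<and> \<alpha> \<in> root_series N" D] assms
  by (auto simp: puiseux_index_def)

text \<open>\<open>subst_puiseux\<close> uses the index of \<gamma> as denominator. Rewriting both
  sides over the common denominator \<open>D * N\<close> shows that \<open>D\<close> gives the same
  series.\<close>

lemma subst_puiseux_eq:
  assumes "D > 0" "\<gamma> \<in> puiseux_series" "root_support D \<gamma>" "\<gamma> 0 = 0"
  shows "subst_puiseux f \<gamma> = of_root D (subst_snd (ramify D f) (to_root D \<gamma>))"
proof -
  define N where "N = puiseux_index \<gamma>"
  obtain D' where "D' > 0" "\<gamma> \<in> root_series D'" using assms(2) by (auto simp: puiseux_series_def)
  from puiseux_index_props[OF this] have N: "N > 0" "root_support N \<gamma>"
    by (simp_all add: N_def root_series_iff)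
  have scale: "to_root (k * E) (of_root E (subst_snd (ramify E f) (to_root E \<gamma>))) =
      subst_snd (ramify (k * E) f) (to_root (k * E) \<gamma>)"
    if "k > 0" "E > 0" "root_support E \<gamma>" for k E
  proof -
    have 0: "fps_nth (fps_X ^ k :: complex fps) 0 = 0" using that by simp
    have g: "fps_nth (to_root E \<gamma>) 0 = 0" using assms(4) by simp
    show ?thesis
      using subst_snd_compose[OF 0 g, of "ramify E f"] that
      by (simp add: to_root_scale of_root_support to_root_of_root ramify_scale)
  qed
  have "of_root N (subst_snd (ramify N f) (to_root N \<gamma>)) =
      of_root D (subst_snd (ramify D f) (to_root D \<gamma>))"
  proof (rule to_root_inject[of "D * N"])
    show "root_support (D * N) (of_root N (subst_snd (ramify N f) (to_root N \<gamma>)))"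
      by (rule root_support_scale[OF assms(1) of_root_support[OF N(1)]])
    show "root_support (D * N) (of_root D (subst_snd (ramify D f) (to_root D \<gamma>)))"
      by (rule root_support_scale'[OF N(1) of_root_support[OF assms(1)]])
    show "to_root (D * N) (of_root N (subst_snd (ramify N f) (to_root N \<gamma>))) =
      to_root (D * N) (of_root D (subst_snd (ramify D f) (to_root D \<gamma>)))"
      using scale[OF assms(1) N] scale[OF N(1) assms(1,3)] by (simp add: mult.commute)
  qed
  then show ?thesis by (simp add: subst_puiseux_def N_def Let_def)
qed

lemma
  assumes "D > 0" "\<gamma> \<in> puiseux_series" "root_support D \<gamma>" "\<gamma> 0 = 0"
  shows to_root_subst_puiseux:
      "to_root D (subst_puiseux f \<gamma>) = subst_snd (ramify D f) (to_root D \<gamma>)"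
    and subst_puiseux_support: "root_support D (subst_puiseux f \<gamma>)"
  by (simp_all add: subst_puiseux_eq[OF assms] assms(1) to_root_of_root of_root_support)

subsection \<open>Contact orders and pseudo-balls\<close>

text \<open>The exponents are \<open>k / D\<close> with natural \<open>k\<close>, so well-ordering
  of the numerators makes the \<open>LEAST\<close> over the rationals in \<open>puiseux_ord\<close>
  a true minimum.\<close>

lemma puiseux_ord_cases:
  assumes "root_support D \<delta>" "D > 0"
  obtains "\<delta> = (\<lambda>_. 0)" "puiseux_ord \<delta> = Pinf"
  | q where "puiseux_ord \<delta> = Fin q" "\<delta> q \<noteq> 0" "\<And>s. s < q \<Longrightarrow> \<delta> s = 0"
proof (cases "\<delta> = (\<lambda>_. 0)")
  case True
  then show ?thesis using that(1) by (simp add: puiseux_ord_def)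
next
  case False
  then obtain k where k: "\<delta> (of_nat k / of_nat D) \<noteq> 0"
    using assms(1) unfolding root_support_def by blast
  define k0 where "k0 = (LEAST k. \<delta> (of_nat k / of_nat D) \<noteq> 0)"
  define q where "q = (of_nat k0 / of_nat D :: rat)"
  have q: "\<delta> q \<noteq> 0" unfolding q_def k0_def by (rule LeastI[of _ k]) (rule k)
  have below: "\<delta> s = 0" if "s < q" for s
  proof (rule ccontr)
    assume s: "\<delta> s \<noteq> 0"
    then obtain j where j: "s = of_nat j / of_nat D" using assms(1) unfolding root_support_def by blast
    then have "k0 \<le> j" unfolding k0_def using s by (intro Least_le) simp
    then have "q \<le> s" using assms(2) by (simp add: j q_def divide_right_mono)
    then show False using that by simp
  qed
  have "(LEAST q. \<delta> q \<noteq> 0) = q"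
    by (rule Least_equality) (use q below in \<open>auto simp: not_less[symmetric]\<close>)
  then have "puiseux_ord \<delta> = Fin q" using False by (simp add: puiseux_ord_def)
  then show ?thesis using that(2) q below by blast
qed

lemma puiseux_common_support:
  assumes "\<alpha> \<in> puiseux_series" "\<beta> \<in> puiseux_series"
  obtains D where "D > 0" "root_support D \<alpha>" "root_support D \<beta>"
proof -
  obtain D E where "D > 0" "root_support D \<alpha>" "E > 0" "root_support E \<beta>"
    using assms puiseux_series_support by meson
  then show ?thesis
    using that[of "D * E"] root_support_scale[of D E \<beta>] root_support_scale'[of E D \<alpha>] by simp
qed

lemma contact_ge_iff:
  assumes "\<alpha> \<in> puiseux_series" "\<beta> \<in> puiseux_series"
  shows "contact \<alpha> \<beta> \<ge> Fin h \<longleftrightarrow> (\<forall>q<h. \<alpha> q = \<beta> q)"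
proof -
  obtain D where D: "D > 0" "root_support D \<alpha>" "root_support D \<beta>"
    using puiseux_common_support[OF assms] .
  show ?thesis unfolding contact_def
  proof (rule puiseux_ord_cases[OF root_support_diff[OF D(2,3)] D(1)], goal_cases)
    case 1
    from fun_cong[OF 1(1)] have "\<alpha> = \<beta>" by auto
    then show ?case using 1(2) by simp
  next
    case (2 q)
    then have q: "\<alpha> q \<noteq> \<beta> q" "\<And>s. s < q \<Longrightarrow> \<alpha> s = \<beta> s" by auto
    have "h \<le> q \<longleftrightarrow> (\<forall>s<h. \<alpha> s = \<beta> s)"
    proof
      assume "\<forall>s<h. \<alpha> s = \<beta> s"
      then show "h \<le> q" using q(1) by (auto simp: not_less[symmetric])
    qed (use q(2) in auto)
    then show ?case by (simp add: 2(1))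
  qed
qed

lemma contact_le_iff:
  assumes "\<alpha> \<in> puiseux_series" "\<beta> \<in> puiseux_series"
  shows "contact \<alpha> \<beta> \<le> Fin h \<longleftrightarrow> (\<exists>q\<le>h. \<alpha> q \<noteq> \<beta> q)"
proof -
  obtain D where D: "D > 0" "root_support D \<alpha>" "root_support D \<beta>"
    using puiseux_common_support[OF assms] .
  show ?thesis unfolding contact_def
  proof (rule puiseux_ord_cases[OF root_support_diff[OF D(2,3)] D(1)], goal_cases)
    case 1
    from fun_cong[OF 1(1)] have "\<alpha> = \<beta>" by auto
    then show ?case using 1(2) by simp
  next
    case (2 q)
    then have q: "\<alpha> q \<noteq> \<beta> q" "\<And>s. s < q \<Longrightarrow> \<alpha> s = \<beta> s" by auto
    have "q \<le> h \<longleftrightarrow> (\<exists>s\<le>h. \<alpha> s \<noteq> \<beta> s)"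
    proof
      assume "\<exists>s\<le>h. \<alpha> s \<noteq> \<beta> s"
      then obtain s where "s \<le> h" "\<alpha> s \<noteq> \<beta> s" by blast
      then show "q \<le> h" using q(2)[of s] by (cases "s < q") auto
    qed (use q(1) in auto)
    then show ?case by (simp add: 2(1))
  qed
qed

lemma contact_eq_iff:
  assumes "\<alpha> \<in> puiseux_series" "\<beta> \<in> puiseux_series"
  shows "contact \<alpha> \<beta> = Fin h \<longleftrightarrow> (\<forall>q<h. \<alpha> q = \<beta> q) \<and> \<alpha> h \<noteq> \<beta> h"
proof -
  have "contact \<alpha> \<beta> = Fin h \<longleftrightarrow> contact \<alpha> \<beta> \<ge> Fin h \<and> contact \<alpha> \<beta> \<le> Fin h" by auto
  then show ?thesis
    unfolding contact_ge_iff[OF assms] contact_le_iff[OF assms] by (auto simp: le_less)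
qed

lemma fractional_series_zero:
  assumes "\<alpha> \<in> fractional_series" "q \<le> 0"
  shows "\<alpha> q = 0"
proof -
  have \<alpha>: "\<alpha> \<in> puiseux_series" "puiseux_ord \<alpha> > Fin 0" using assms by (auto simp: fractional_series_def)
  obtain D where "D > 0" "root_support D \<alpha>" using puiseux_series_support[OF \<alpha>(1)] by blast
  then show ?thesis using puiseux_ord_cases[of D \<alpha>] \<alpha>(2) assms(2)
    by (metis less_extended_simps(1) order.strict_trans1)
qed

text \<open>Only finitely many coefficients are nonzero, so the radius of convergence is
  infinite.\<close>

lemma truncated_root_series:
  assumes "D > 0" "root_support D \<alpha>" "\<And>q. q > h \<Longrightarrow> \<alpha> q = 0"
  shows "\<alpha> \<in> root_series D"
proof -
  obtain m :: nat where m: "h * of_nat D < of_nat m" using reals_Archimedean2 by blast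
  have "\<alpha> (of_nat k / of_nat D) = 0" if "k \<ge> m" for k
  proof (rule assms(3))
    have "h * of_nat D < of_nat k" using m that by (meson of_nat_le_iff order.strict_trans2)
    then show "h < of_nat k / of_nat D" using assms(1) by (simp add: pos_less_divide_eq)
  qed
  then have "eventually (\<lambda>k. fps_nth (to_root D \<alpha>) k = 0) sequentially"
    by (auto simp: eventually_sequentially)
  then have "conv_radius (fps_nth (to_root D \<alpha>)) = conv_radius (\<lambda>_. 0 :: complex)"
    by (intro conv_radius_cong') simp
  then have "fps_conv_radius (to_root D \<alpha>) = \<infinity>" by (simp add: fps_conv_radius_def)
  then show ?thesis using assms by (simp add: root_series_iff)
qed

lemma mem_pseudo_ball:
  "\<alpha> \<in> puiseux_series \<Longrightarrow>
    \<gamma> \<in> pseudo_ball \<alpha> h \<longleftrightarrow> \<gamma> \<in> puiseux_series \<and> (\<forall>q<h. \<gamma> q = \<alpha> q)"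
  by (auto simp: pseudo_ball_def contact_ge_iff)

lemma pseudo_ball_cong:
  "\<alpha> \<in> puiseux_series \<Longrightarrow> \<beta> \<in> puiseux_series \<Longrightarrow> \<forall>q<h. \<alpha> q = \<beta> q \<Longrightarrow>
    pseudo_ball \<alpha> h = pseudo_ball \<beta> h"
  by (auto simp: mem_pseudo_ball)

text \<open>For \<alpha> in \<open>B\<close> and \<open>h = h(B)\<close> this is the test series
  \<open>\<lambda>\<^sub>B + c x^h\<close>; \<open>c = 0\<close> gives the stem itself.\<close>

definition truncation :: "puiseux \<Rightarrow> rat \<Rightarrow> complex \<Rightarrow> puiseux" where
  "truncation \<alpha> h c = (\<lambda>q. if q < h then \<alpha> q else if q = h then c else 0)"

lemma truncation_root_series:
  assumes "D > 0" "root_support D \<alpha>" "h = of_nat e / of_nat D"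
  shows "truncation \<alpha> h c \<in> root_series D"
proof (rule truncated_root_series[OF assms(1)])
  show "root_support D (truncation \<alpha> h c)"
    using assms by (auto simp: root_support_def truncation_def)
qed (auto simp: truncation_def)

lemma truncation_puiseux:
  assumes "\<alpha> \<in> puiseux_series" "h > 0"
  shows "truncation \<alpha> h c \<in> puiseux_series"
proof -
  obtain D where D: "D > 0" "root_support D \<alpha>" using puiseux_series_support[OF assms(1)] by blast
  obtain a b where ab: "h = of_int a / of_int b" "b > 0" by (cases h) (auto simp: Fract_of_int_quotient)
  then have "a > 0" using assms(2) by (simp add: zero_less_divide_iff)
  have h: "h = of_nat (nat a * D) / of_nat (D * nat b)" using ab \<open>a > 0\<close> D by simp
  have "nat b > 0" using ab by simp
  then show ?thesis
    using truncation_root_series[OF _ root_support_scale'[OF _ D(2)] h] root_series_puiseux D(1)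
    by (metis nat_0_less_mult_iff)
qed

text \<open>If equal balls had different heights, a series in the ball of lower height could be
  given any coefficient at that height, whereas the larger height prescribes this
  coefficient.\<close>

lemma height_pseudo_ball:
  assumes "\<alpha> \<in> puiseux_series" "h > 0"
  shows "height (pseudo_ball \<alpha> h) = h"
  unfolding height_def
proof (rule the_equality)
  show "h > 0 \<and> (\<exists>\<beta>\<in>puiseux_series. pseudo_ball \<alpha> h = pseudo_ball \<beta> h)" using assms by blast
  have le: "h \<le> h'" if "\<alpha> \<in> puiseux_series" "\<beta> \<in> puiseux_series" "h' > 0"
    "pseudo_ball \<alpha> h = pseudo_ball \<beta> h'" for \<alpha> \<beta> h h'
  proof (rule ccontr)
    assume "\<not> h \<le> h'"
    define \<delta> where "\<delta> = truncation \<beta> h' (\<alpha> h' + 1)"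
    have "\<delta> \<in> pseudo_ball \<beta> h'" using that truncation_puiseux by (simp add: \<delta>_def mem_pseudo_ball)
      (simp add: truncation_def)
    then have "\<forall>q<h. \<delta> q = \<alpha> q" using mem_pseudo_ball[OF that(1)] that(4) by metis
    then have "\<delta> h' = \<alpha> h'" using \<open>\<not> h \<le> h'\<close> by simp
    then show False by (simp add: \<delta>_def truncation_def)
  qed
  fix h' assume "h' > 0 \<and> (\<exists>\<beta>\<in>puiseux_series. pseudo_ball \<alpha> h = pseudo_ball \<beta> h')"
  then show "h' = h" using le assms by (metis order_antisym)
qed

lemma agree_to_root_iff:
  assumes D: "D > 0" "root_support D \<alpha>" "root_support D \<beta>"
  shows "agree e (to_root D \<alpha>) (to_root D \<beta>) \<longleftrightarrow> (\<forall>q < of_nat e / of_nat D. \<alpha> q = \<beta> q)"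
proof
  assume *: "agree e (to_root D \<alpha>) (to_root D \<beta>)"
  show "\<forall>q < of_nat e / of_nat D. \<alpha> q = \<beta> q"
  proof (intro allI impI, rule ccontr)
    fix q assume q: "q < of_nat e / of_nat D" "\<alpha> q \<noteq> \<beta> q"
    then obtain k where k: "q = of_nat k / of_nat D"
      using root_support_diff[OF D(2,3)] unfolding root_support_def by auto
    then have "k < e" using q(1) D(1) by (simp add: divide_less_cancel)
    then show False using * q(2) by (simp add: agree_def k)
  qed
qed (use D(1) in \<open>auto simp: agree_def divide_strict_right_mono\<close>)

lemma agree_Suc_to_root_iff:
  assumes D: "D > 0" "root_support D \<alpha>" "root_support D \<beta>"
  shows "agree (Suc e) (to_root D \<alpha>) (to_root D \<beta>) \<longleftrightarrow> (\<forall>q \<le> of_nat e / of_nat D. \<alpha> q = \<beta> q)"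
proof -
  have "agree (Suc e) (to_root D \<alpha>) (to_root D \<beta>) \<longleftrightarrow>
      agree e (to_root D \<alpha>) (to_root D \<beta>) \<and> \<alpha> (of_nat e / of_nat D) = \<beta> (of_nat e / of_nat D)"
    by (auto simp: agree_def less_Suc_eq)
  then show ?thesis unfolding agree_to_root_iff[OF D] by (auto simp: le_less)
qed

lemma to_root_conj_series:
  "D > 0 \<Longrightarrow> to_root D (conj_series D \<theta> \<alpha>) = rot \<theta> (to_root D \<alpha>)"
  by (simp add: fps_eq_iff rot_nth conj_series_def)

lemma conj_series_root_series:
  assumes "D > 0" "\<alpha> \<in> root_series D" "norm \<theta> = 1"
  shows "conj_series D \<theta> \<alpha> \<in> root_series D"
proof -
  have "root_support D (conj_series D \<theta> \<alpha>)"
    using root_series_support[OF assms(1,2)] by (auto simp: root_support_def conj_series_def)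
  moreover have "fps_conv_radius (rot \<theta> (to_root D \<alpha>)) = fps_conv_radius (to_root D \<alpha>)"
    using fps_conv_radius_norm[of "rot \<theta> (to_root D \<alpha>)"] fps_conv_radius_norm[of "to_root D \<alpha>"]
    by (simp add: rot_nth norm_mult norm_power assms(3))
  ultimately show ?thesis
    using assms by (simp add: root_series_iff to_root_conj_series)
qed

text \<open>A root may have a denominator \<open>E\<close> unrelated to \<open>D\<close>. Over
  \<open>E * D\<close> the factorization becomes a vanishing product in an integral domain, and the
  factor coming from \<open>U\<close> has nonzero constant term.\<close>

lemma Zer_eq:
  assumes D: "D > 0"
    and roots: "\<And>i. i \<in> I \<Longrightarrow> \<alpha> i \<in> fractional_series \<inter> root_series D" "finite I"
    and U: "fps_nth (fps_nth U 0) 0 \<noteq> 0"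
    and fac: "ramify D f = ramify D U * (\<Prod>i\<in>I. fps_X - fps_const (to_root D (\<alpha> i)))"
  shows "Zer f = \<alpha> ` I"
proof
  show "\<alpha> ` I \<subseteq> Zer f"
  proof
    fix \<beta> assume "\<beta> \<in> \<alpha> ` I"
    then obtain i where i: "i \<in> I" "\<beta> = \<alpha> i" by auto
    note r = roots(1)[OF i(1)]
    have \<alpha>: "\<alpha> i \<in> puiseux_series" "root_support D (\<alpha> i)" "\<alpha> i 0 = 0"
      using r root_series_puiseux[OF D] root_series_support[OF D] fractional_series_zero by auto
    have g: "fps_nth (to_root D (\<alpha> i)) 0 = 0" using \<alpha>(3) by simp
    have "subst_snd (ramify D f) (to_root D (\<alpha> i)) = 0"
      unfolding fac subst_snd_mult[OF g] subst_snd_prod[OF g] subst_snd_linear[OF g]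
      using i(1) roots(2) by auto
    then have "to_root D (subst_puiseux f (\<alpha> i)) = to_root D (\<lambda>_. 0)"
      unfolding to_root_subst_puiseux[OF D \<alpha>] by (simp add: fps_eq_iff)
    then have "subst_puiseux f (\<alpha> i) = (\<lambda>_. 0)"
      using to_root_inject[OF subst_puiseux_support[OF D \<alpha>]] by (simp add: root_support_def)
    then show "\<beta> \<in> Zer f" using r i by (simp add: Zer_def)
  qed
  show "Zer f \<subseteq> \<alpha> ` I"
  proof
    fix \<beta> assume "\<beta> \<in> Zer f"
    then have \<beta>: "\<beta> \<in> puiseux_series" "\<beta> 0 = 0" and sub: "subst_puiseux f \<beta> = (\<lambda>_. 0)"
      using fractional_series_zero by (auto simp: Zer_def fractional_series_def)
    obtain E where E: "E > 0" "root_support E \<beta>" using puiseux_series_support[OF \<beta>(1)] by blast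
    have ED: "E * D > 0" using E D by simp
    have supp: "root_support (E * D) \<beta>" by (rule root_support_scale'[OF D E(2)])
    have g: "fps_nth (to_root (E * D) \<beta>) 0 = 0" using \<beta>(2) by simp
    have 0: "fps_nth (fps_X ^ E :: complex fps) 0 = 0" using E by simp
    have "ramify (E * D) f = comp_fst (fps_X ^ E) (ramify D U) *
        (\<Prod>i\<in>I. fps_X - fps_const (fps_compose (to_root D (\<alpha> i)) (fps_X ^ E)))"
      unfolding ramify_scale[OF E(1) D] fac
      by (simp add: comp_fst_mult[OF 0] comp_fst_prod[OF 0] comp_fst_diff)
    also have "(\<Prod>i\<in>I. fps_X - fps_const (fps_compose (to_root D (\<alpha> i)) (fps_X ^ E))) =
        (\<Prod>i\<in>I. fps_X - fps_const (to_root (E * D) (\<alpha> i)))"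
      using roots(1) by (intro prod.cong) (simp_all add: to_root_scale[OF E(1) D] root_series_support[OF D])
    finally have "subst_snd (comp_fst (fps_X ^ E) (ramify D U)) (to_root (E * D) \<beta>) *
        (\<Prod>i\<in>I. to_root (E * D) \<beta> - to_root (E * D) (\<alpha> i)) = to_root (E * D) (\<lambda>_. 0)"
      using to_root_subst_puiseux[OF ED \<beta>(1) supp \<beta>(2), of f] sub
      by (simp add: subst_snd_mult[OF g] subst_snd_prod[OF g] subst_snd_linear[OF g])
    also have "to_root (E * D) (\<lambda>_. 0) = 0" by (simp add: fps_eq_iff)
    finally have "subst_snd (comp_fst (fps_X ^ E) (ramify D U)) (to_root (E * D) \<beta>) = 0 \<or>
        (\<exists>i\<in>I. to_root (E * D) \<beta> = to_root (E * D) (\<alpha> i))"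
      using roots(2) by auto
    moreover have "fps_nth (subst_snd (comp_fst (fps_X ^ E) (ramify D U)) (to_root (E * D) \<beta>)) 0 \<noteq> 0"
      using U by (simp add: subst_snd_nth_0 ramify_eq_comp_fst)
    ultimately obtain i where i: "i \<in> I" "to_root (E * D) \<beta> = to_root (E * D) (\<alpha> i)" by auto
    then have "\<beta> = \<alpha> i"
      using roots(1)[OF i(1)] by (intro to_root_inject[OF supp])
        (auto intro: root_support_scale[OF E(1)] root_series_support[OF D])
    then show "\<beta> \<in> \<alpha> ` I" using i by simp
  qed
qed

lemma primitive_root_exists:
  assumes "D > 0"
  obtains \<omega> :: complex where "\<And>k. \<omega> ^ k = 1 \<longleftrightarrow> D dvd k" "\<And>\<theta>. \<theta> ^ D = 1 \<Longrightarrow> \<exists>k. \<theta> = \<omega> ^ k"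
proof -
  define \<omega> where "\<omega> = exp (2 * of_real pi * \<i> / of_nat D)"
  have pow: "\<omega> ^ k = exp (2 * of_real pi * \<i> * of_nat k / of_nat D)" for k
    by (simp add: \<omega>_def mult_ac flip: exp_of_nat_mult)
  show ?thesis
  proof (rule that[of \<omega>])
    show "\<omega> ^ k = 1 \<longleftrightarrow> D dvd k" for k
      unfolding pow using complex_root_unity_eq_1[of D k] assms by simp
    fix \<theta> :: complex assume "\<theta> ^ D = 1"
    then have "\<theta> \<in> {exp (2 * of_real pi * \<i> * of_nat j / of_nat D) | j. j < D}"
      using complex_roots_unity[of D] assms by auto
    then show "\<exists>k. \<theta> = \<omega> ^ k" by (auto simp: pow)
  qed
qed

lemma bunit_nth_0:
  assumes "bunit U"
  shows "fps_nth (fps_nth U 0) 0 \<noteq> 0"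
proof -
  obtain w where "U * w = 1" using assms by (auto simp: bunit_def)
  then have "fps_nth (fps_nth (U * w) 0) 0 = 1" by simp
  then show ?thesis by auto
qed

lemma agree_rot_iff:
  "\<theta> \<noteq> 0 \<Longrightarrow> agree e (rot \<theta> g) (rot \<theta> h) \<longleftrightarrow> agree e g h"
  by (simp add: agree_def rot_nth)

text \<open>The hypotheses say \<open>X / D = m / n\<close> in lowest terms. Hence
  \<open>\<omega> ^ X\<close> has order \<open>n\<close> for a primitive \<open>D\<close>-th root
  \<omega>; the cases used are \<open>X = N * e\<close> and \<open>X = Q\<close>.\<close>

lemma dvd_mult_transfer:
  fixes X n m D k :: nat
  assumes "n > 0" "D > 0" "X * n = m * D" "coprime m n"
  shows "D dvd X * k \<longleftrightarrow> n dvd k"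
proof -
  have "D dvd X * k \<longleftrightarrow> D * n dvd X * k * n" using assms(1) by simp
  also have "X * k * n = D * (m * k)" using assms(3) by (metis mult.assoc mult.commute)
  also have "D * n dvd D * (m * k) \<longleftrightarrow> n dvd m * k" using assms(2) by simp
  also have "\<dots> \<longleftrightarrow> n dvd k" using assms(4) by (simp add: coprime_dvd_mult_right_iff coprime_commute)
  finally show ?thesis .
qed

text \<open>Each exponent \<open>k / D\<close> of \<sigma> is also some \<open>j / N\<close>, so
  \<open>D\<close> divides \<open>N * k\<close> and the coefficient is multiplied by 1.\<close>

lemma rot_to_root_period:
  assumes "D > 0" "N > 0" "\<omega> ^ D = 1" "root_support N \<sigma>"
  shows "rot (\<omega> ^ N) (to_root D \<sigma>) = to_root D \<sigma>"
proof (rule fps_ext)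
  fix k
  show "fps_nth (rot (\<omega> ^ N) (to_root D \<sigma>)) k = fps_nth (to_root D \<sigma>) k"
  proof (cases "\<sigma> (of_nat k / of_nat D) = 0")
    case False
    then obtain j where "of_nat k / of_nat D = (of_nat j / of_nat N :: rat)"
      using assms(4) unfolding root_support_def by blast
    then have "N * k = D * j" using of_nat_div_eq_iff[OF assms(1,2)] by (simp add: mult.commute)
    then have "(\<omega> ^ N) ^ k = (\<omega> ^ D) ^ j" by (simp flip: power_mult)
    then show ?thesis by (simp add: rot_nth assms(3))
  qed (simp add: rot_nth)
qed

text \<open>If \<open>\<omega> ^ d\<close> fixed \<sigma>, all exponents would have denominator
  \<open>gcd d D \<le> d\<close>; as a finite sum \<sigma> would lie in that
  \<open>root_series\<close>, against the minimality of the index. This makes the conjugates of a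
  stem distinct.\<close>

lemma rot_to_root_minimal:
  assumes D: "D > 0" and \<omega>: "\<And>k. \<omega> ^ k = (1::complex) \<longleftrightarrow> D dvd k"
    and \<sigma>: "root_support D \<sigma>" "\<And>q. q > h \<Longrightarrow> \<sigma> q = 0"
    and d: "0 < d" "d < puiseux_index \<sigma>"
  shows "rot (\<omega> ^ d) (to_root D \<sigma>) \<noteq> to_root D \<sigma>"
proof
  assume eq: "rot (\<omega> ^ d) (to_root D \<sigma>) = to_root D \<sigma>"
  define g where "g = gcd d D"
  have g: "g > 0" "g \<le> d" using d(1) by (auto simp: g_def)
  have "root_support g \<sigma>" unfolding root_support_def
  proof (intro allI impI)
    fix q assume "\<sigma> q \<noteq> 0"
    then obtain k where k: "q = of_nat k / of_nat D" using \<sigma>(1) unfolding root_support_def by blast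
    have "(\<omega> ^ d) ^ k * \<sigma> q = \<sigma> q"
      using arg_cong[OF eq, of "\<lambda>a. fps_nth a k"] by (simp add: rot_nth k)
    then have "\<omega> ^ (d * k) = 1" using \<open>\<sigma> q \<noteq> 0\<close> by (simp add: power_mult)
    then have "D dvd d * k" by (simp add: \<omega>)
    then have "D dvd gcd (d * k) (D * k)" by simp
    also have "gcd (d * k) (D * k) = g * k" by (simp add: g_def gcd_mult_distrib_nat mult.commute[of _ k])
    finally obtain j where "k * g = j * D" by (metis dvd_def mult.commute)
    then show "\<exists>j. q = of_nat j / of_nat g" unfolding k using of_nat_div_eq_iff[OF D g(1)] by blast
  qed
  then have "\<sigma> \<in> root_series g" by (intro truncated_root_series[OF g(1) _ \<sigma>(2)])
  then show False using puiseux_index_props(3)[OF g(1)] g(2) d(2) by fastforce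
qed

theorem proposition5p6:
  fixes f U U' :: bseries
    and \<alpha> \<gamma> :: "nat \<Rightarrow> puiseux"
    and B :: "puiseux set"
    and F H :: "complex poly"
    and q :: rat
    and C :: complex
    and t w :: "nat \<Rightarrow> complex"
    and J :: "nat set"
    and p D N m n L M r :: nat
  assumes f: "bconvergent f" "breduced f" "bcoeff f 0 0 = 0" "\<exists>j. bcoeff f 0 j \<noteq> 0"
    and D: "D > 0"
    and roots: "\<And>i. i \<in> {1..p} \<Longrightarrow> \<alpha> i \<in> fractional_series \<inter> root_series D"
      "inj_on \<alpha> {1..p}"
    and polar_roots: "\<And>j. j \<in> {1..p-1} \<Longrightarrow> \<gamma> j \<in> fractional_series \<inter> root_series D"
    and factorization: "bunit U"
      "ramify D f = ramify D U * (\<Prod>i=1..p. fps_X - fps_const (to_root D (\<alpha> i)))"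
    and polar_factorization: "bunit U'"
      "ramify D (fps_deriv f) = ramify D U' * (\<Prod>j=1..p-1. fps_X - fps_const (to_root D (\<gamma> j)))"
    and B: "B \<in> tree f"
    and FB: "leading_data f B F q"
    and N: "N = puiseux_index (ball_stem B)"
    and pos: "m > 0" "n > 0" "L > 0" "M > 0"
    and hB: "height B = of_nat m / of_nat (n * N)" "coprime m n"
    and qB: "q = of_nat L / of_nat M" "coprime L M"
    and HB: "pcompose H (monom 1 n) = F ^ M"
    and HB': "pderiv H = smult C (\<Prod>j=1..r. [:- t j, 1:])"
    and w: "w 0 = poly H 0" "\<And>j. j \<in> {1..r} \<Longrightarrow> w j = poly H (t j)"
    and J: "J = {j \<in> {1..r}. w j \<noteq> 0}"
  shows "(w 0 \<noteq> 0 \<longrightarrow> M dvd (n - 1) * N) \<and>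
         (J \<noteq> {} \<longrightarrow> M dvd n * N) \<and>
         newton_initial (disc_orbit f \<alpha> \<gamma> p D B) =
           (if w 0 \<noteq> 0
            then quasi_factor M L (w 0) ^ ((n - 1) * N div M) *
                 (\<Prod>j\<in>J. quasi_factor M L (w j) ^ (n * N div M))
            else (\<Prod>j\<in>J. quasi_factor M L (w j) ^ (n * N div M)))"
proof -

  \<comment> \<open>Roots of unity and the given roots in the variable \<open>s\<close>\<close>
  obtain \<omega> :: complex where \<omega>: "\<And>k. \<omega> ^ k = 1 \<longleftrightarrow> D dvd k"
    and \<omega>_all: "\<And>\<theta>. \<theta> ^ D = 1 \<Longrightarrow> \<exists>k. \<theta> = \<omega> ^ k"
    using primitive_root_exists[OF D] by blast
  have \<omega>D: "(\<omega> ^ k) ^ D = 1" for k using \<omega>[of "k * D"] by (simp add: power_mult)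
  have root_nz: "\<theta> \<noteq> 0" "norm \<theta> = 1" if "\<theta> ^ D = 1" for \<theta> :: complex
  proof -
    show "\<theta> \<noteq> 0" using that D by (auto simp: power_0_left)
    have "norm \<theta> ^ D = 1" using that by (metis norm_one norm_power)
    then show "norm \<theta> = 1" using D power_eq_imp_eq_base[of "norm \<theta>" D 1] by simp
  qed
  define a where "a = (\<lambda>i. to_root D (\<alpha> i))"
  define c where "c = (\<lambda>j. to_root D (\<gamma> j))"
  define \<phi> where "\<phi> = subst_snd (ramify D f)"
  have \<alpha>: "\<alpha> i \<in> puiseux_series" "root_support D (\<alpha> i)" "\<alpha> i \<in> root_series D"
      "\<And>q. q \<le> 0 \<Longrightarrow> \<alpha> i q = 0" if "i \<in> {1..p}" for i
    using roots(1)[OF that] root_series_puiseux[OF D] root_series_support[OF D] fractional_series_zero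
    by auto
  have \<gamma>: "\<gamma> j \<in> puiseux_series" "root_support D (\<gamma> j)" "\<gamma> j 0 = 0" if "j \<in> {1..p-1}" for j
    using polar_roots[OF that] root_series_puiseux[OF D] root_series_support[OF D] fractional_series_zero
    by auto
  have U0: "fps_nth (fps_nth U 0) 0 \<noteq> 0" and U0': "fps_nth (fps_nth U' 0) 0 \<noteq> 0"
    using bunit_nth_0 factorization(1) polar_factorization(1) by auto
  have Zf: "Zer f = \<alpha> ` {1..p}"
    using Zer_eq[OF D roots(1) _ U0 factorization(2)] by simp

  \<comment> \<open>The ball, its height and its stem\<close>
  obtain i0 i1 h where i01: "i0 \<in> {1..p}" "i1 \<in> {1..p}" and Bdef: "B = pseudo_ball (\<alpha> i0) h"
    and cont: "contact (\<alpha> i0) (\<alpha> i1) = Fin h"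
    using B unfolding tree_def Zf by blast
  have sep: "\<forall>q<h. \<alpha> i0 q = \<alpha> i1 q" "\<alpha> i0 h \<noteq> \<alpha> i1 h"
    using cont contact_eq_iff[OF \<alpha>(1)[OF i01(1)] \<alpha>(1)[OF i01(2)]] by auto
  have h: "h > 0" using sep(2) \<alpha>(4)[OF i01(1), of h] \<alpha>(4)[OF i01(2), of h] by (cases "h \<le> 0") auto
  obtain e where e: "h = of_nat e / of_nat D"
    using sep(2) root_support_diff[OF \<alpha>(2)[OF i01(1)] \<alpha>(2)[OF i01(2)]]
    unfolding root_support_def by auto
  have e0: "e > 0" using h e by (cases e) auto
  have hgt: "height B = h" unfolding Bdef by (rule height_pseudo_ball[OF \<alpha>(1)[OF i01(1)] h])
  define \<sigma> where "\<sigma> = ball_stem B"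
  define tr where "tr = truncation (\<alpha> i0) h"
  have "\<alpha> i0 \<in> B" using \<alpha>(1)[OF i01(1)] by (simp add: Bdef mem_pseudo_ball)
  then have "(SOME \<alpha>. \<alpha> \<in> B) \<in> B" by (rule someI[where P = "\<lambda>\<alpha>. \<alpha> \<in> B"])
  then have "\<forall>q<h. (SOME \<alpha>. \<alpha> \<in> B) q = \<alpha> i0 q"
    unfolding Bdef mem_pseudo_ball[OF \<alpha>(1)[OF i01(1)]] by blast
  \<comment> \<open>The element of \<open>B\<close> picked by \<open>SOME\<close> enters only below
    the height, where it agrees with \<open>\<alpha> i0\<close>.\<close>
  then have stem: "\<sigma> = tr 0"
    by (auto simp: \<sigma>_def tr_def truncation_def ball_stem_def hgt fun_eq_iff)
  have tr: "tr x \<in> root_series D" "tr x \<in> puiseux_series" "root_support D (tr x)" "tr x 0 = 0" for x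
  proof -
    show *: "tr x \<in> root_series D"
      unfolding tr_def by (rule truncation_root_series[OF D \<alpha>(2)[OF i01(1)] e])
    show "tr x \<in> puiseux_series" "root_support D (tr x)"
      using root_series_puiseux[OF D *] root_series_support[OF D *] by auto
    show "tr x 0 = 0" using h \<alpha>(4)[OF i01(1), of 0] by (simp add: tr_def truncation_def)
  qed
  define lam where "lam = to_root D \<sigma>"
  have tr_nth: "fps_nth (to_root D (tr x)) k =
      (if k < e then fps_nth (a i0) k else if k = e then x else 0)" for x k
    using D by (auto simp: tr_def truncation_def e a_def divide_less_cancel)
  have lam_nth: "fps_nth lam k = (if k < e then fps_nth (a i0) k else 0)" for k
    unfolding lam_def stem tr_nth by simp
  have tr_agree: "agree e (to_root D (tr x)) lam" for x
    unfolding agree_def tr_nth lam_nth by simp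
  have tr_0: "fps_nth (to_root D (tr x)) 0 = 0" for x using tr(4) by simp
  have a_lam: "agree e (a i0) lam" "agree e (a i1) lam"
    using sep(1) agree_to_root_iff[OF D \<alpha>(2)[OF i01(1)] \<alpha>(2)[OF i01(2)], of e]
    by (auto simp: agree_def lam_nth a_def e)
  have a_sep: "fps_nth (a i0) e \<noteq> fps_nth (a i1) e" using sep(2) by (simp add: a_def e)

  have \<sigma>D: "\<sigma> \<in> root_series D" using tr(1) stem by simp
  have N': "N > 0" "\<sigma> \<in> root_series N"
    using puiseux_index_props[OF D \<sigma>D] by (simp_all add: N \<sigma>_def)
  have \<sigma>N: "root_support N \<sigma>" by (rule root_series_support[OF N'])

  \<comment> \<open>Leading forms of \<open>f\<close> and its derivative on the ball\<close>
  have ramU: "fps_nth (fps_nth (ramify D V) 0) 0 = fps_nth (fps_nth V 0) 0" for V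
    by (simp add: ramify_eq_comp_fst)
  have XD0: "fps_nth (fps_X ^ D :: complex fps) 0 = 0" using D by simp
  obtain Q K p1 where K: "K \<noteq> 0"
    and p1: "p1 = smult K (\<Prod>i\<in>{i\<in>{1..p}. agree e (a i) lam}. [:- fps_nth (a i) e, 1:])"
    and lead1: "\<forall>g. fps_nth g 0 = 0 \<longrightarrow> agree e g lam \<longrightarrow>
      lead (subst_snd (ramify D f) g) Q (poly p1 (fps_nth g e)) \<and>
      lead (fps_X ^ e * subst_snd (fps_deriv (ramify D f)) g) Q (poly (pderiv p1) (fps_nth g e))"
    using lead_unit_family[of "{1..p}" e "ramify D U" a lam] e0 U0 ramU[of U]
    unfolding factorization(2) a_def by (auto simp del: One_nat_def)
  obtain Q' K' p2 where K': "K' \<noteq> 0"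
    and p2: "p2 = smult K' (\<Prod>j\<in>{j\<in>{1..p-1}. agree e (c j) lam}. [:- fps_nth (c j) e, 1:])"
    and lead2: "\<forall>g. fps_nth g 0 = 0 \<longrightarrow> agree e g lam \<longrightarrow>
      lead (subst_snd (ramify D (fps_deriv f)) g) Q' (poly p2 (fps_nth g e))"
    using lead_unit_family[of "{1..p-1}" e "ramify D U'" c lam] e0 U0' ramU[of U']
    unfolding polar_factorization(2) c_def by (auto simp del: One_nat_def)
  have p1_root: "poly p1 x = 0 \<longleftrightarrow> (\<exists>i\<in>{1..p}. agree e (a i) lam \<and> fps_nth (a i) e = x)" for x
    using K by (auto simp: p1 poly_prod)
  have p1_nz: "p1 \<noteq> 0" using K by (simp add: p1)
  have "degree p1 > 0"
  proof (rule ccontr)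
    assume "\<not> degree p1 > 0"
    then obtain b where "p1 = [:b:]" using degree_eq_zeroE[of p1] by auto
    moreover have "poly p1 (fps_nth (a i0) e) = 0" using p1_root i01(1) a_lam(1) by blast
    ultimately show False using p1_nz by simp
  qed
  then have p1': "pderiv p1 \<noteq> 0" by (simp add: pderiv_eq_0_iff)
  have p2_nz: "p2 \<noteq> 0" using K' by (simp add: p2)
  \<comment> \<open>The same series is expanded twice, by the product rule for \<open>f\<close> and
    by the factorization of the derivative. Comparing for all \<open>x\<close> identifies
    \<open>p2\<close> with \<open>pderiv p1\<close>.\<close>
  have "lead (fps_X ^ e * subst_snd (fps_deriv (ramify D f)) (to_root D (tr x))) Q (poly (pderiv p1) x)" for x
    using lead1 tr_0[of x] tr_agree[of x] tr_nth[of x e] by (metis less_irrefl)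
  moreover have "lead (fps_X ^ e * subst_snd (fps_deriv (ramify D f)) (to_root D (tr x))) (e + Q') (poly p2 x)" for x
  proof -
    have "lead (fps_X ^ e) e 1" by (simp add: lead_def)
    moreover have "lead (subst_snd (ramify D (fps_deriv f)) (to_root D (tr x))) Q' (poly p2 x)"
      using lead2 tr_0[of x] tr_agree[of x] tr_nth[of x e] by (metis less_irrefl)
    ultimately show ?thesis
      using lead_mult by (fastforce simp: ramify_eq_comp_fst comp_fst_deriv[OF XD0])
  qed
  ultimately have p12: "pderiv p1 = p2" using p1' p2_nz by (rule lead_poly_unique(2))

  have FB': "\<forall>s<q. subst_puiseux f (tr x) s = 0" "subst_puiseux f (tr x) q = poly F x" for x
  proof -
    have "\<forall>s<height B. tr x s = ball_stem B s" "tr x (height B) = x"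
      by (simp_all add: hgt \<sigma>_def[symmetric] stem) (simp_all add: tr_def truncation_def)
    then show "\<forall>s<q. subst_puiseux f (tr x) s = 0" "subst_puiseux f (tr x) q = poly F x"
      using FB tr(2)[of x] unfolding leading_data_def by blast+
  qed
  have F_nz: "F \<noteq> 0" using FB by (simp add: leading_data_def)
  then obtain x1 where x1: "poly F x1 \<noteq> 0" using poly_all_0_iff_0 by blast
  \<comment> \<open>The series \<open>subst_puiseux f (tr x1)\<close> has denominator
    \<open>D\<close> and a nonzero coefficient at \<open>q\<close>, so \<open>q\<close> is a
    multiple of \<open>1 / D\<close>.\<close>
  obtain Q0 where Q0: "q = of_nat Q0 / of_nat D"
    using subst_puiseux_support[OF D tr(2-4)[of x1], of f] FB'(2)[of x1] x1
    unfolding root_support_def by metis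
  have lead_tr: "lead (subst_snd (ramify D f) (to_root D (tr x))) Q (poly p1 x)" for x
    using lead1 tr_0[of x] tr_agree[of x] tr_nth[of x e] by (metis less_irrefl)
  have lead_F: "lead (subst_snd (ramify D f) (to_root D (tr x))) Q0 (poly F x)" for x
    using FB'[of x] D unfolding to_root_subst_puiseux[OF D tr(2-4)[of x], symmetric]
    by (auto simp: lead_def Q0 divide_strict_right_mono)
  note Q_eq = lead_poly_unique[OF lead_tr lead_F p1_nz F_nz]
  have Fp: "F = p1" using Q_eq(2) by simp
  have F': "pderiv F \<noteq> 0" using p1' Fp by simp
  have q: "q = of_nat Q / of_nat D" using Q0 Q_eq(1) by simp
  have "of_nat Q / of_nat D = (of_nat L / of_nat M :: rat)" using q qB(1) by simp
  then have QM: "Q * M = L * D" using of_nat_div_eq_iff[OF D pos(4)] by simp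
  have Q: "Q > 0" using QM pos D by (cases Q) auto
  have lead: "lead (\<phi> g) Q (poly F (fps_nth g e))" if "fps_nth g 0 = 0" "agree e g lam" for g
    using lead1 that by (simp add: Fp \<phi>_def)

  \<comment> \<open>Divisibility by \<open>M\<close> and equivariance of \<open>F\<close>\<close>
  have dvd_of_support: "M dvd E" if E: "E > 0" "root_support E (tr x)" "poly F x \<noteq> 0" for E x
  proof -
    \<comment> \<open>As \<open>F(x) \<noteq> 0\<close>, the exponent \<open>L / M\<close> occurs in
      a series with denominator \<open>E\<close>; being in lowest terms, it forces \<open>M\<close>
      to divide \<open>E\<close>.\<close>
    obtain j where "q = of_nat j / of_nat E"
      using subst_puiseux_support[OF E(1) tr(2)[of x] E(2) tr(4)[of x], of f] FB'(2)[of x] E(3)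
      unfolding root_support_def by metis
    then have "L * E = j * M" using qB(1) of_nat_div_eq_iff[OF pos(4) E(1), of L j] by simp
    then have "M dvd L * E" by simp
    then show ?thesis using qB(2) by (simp add: coprime_dvd_mult_right_iff coprime_commute)
  qed
  have MnN: "M dvd n * N"
  proof (rule dvd_of_support[OF _ _ x1])
    show "n * N > 0" using pos N' by simp
    show "root_support (n * N) (tr x1)" unfolding root_support_def
    proof (intro allI impI)
      fix s assume s: "tr x1 s \<noteq> 0"
      show "\<exists>k. s = of_nat k / of_nat (n * N)"
      proof (cases "s = h")
        case True
        then show ?thesis using hB(1) hgt by auto
      next
        case False
        then have "\<sigma> s \<noteq> 0" using s by (auto simp: stem tr_def truncation_def split: if_splits)
        then show ?thesis using root_support_scale[OF pos(2) \<sigma>N] unfolding root_support_def by blast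
      qed
    qed
  qed
  \<comment> \<open>At \<open>x = 0\<close> the test series is the stem, which has denominator
    \<open>N\<close> rather than \<open>n * N\<close>.\<close>
  have MN: "M dvd N" if "poly F 0 \<noteq> 0"
    by (rule dvd_of_support[OF N'(1) _ that]) (use \<sigma>N stem in simp)

  have meq: "(N * e) * n = m * D"
    using hB(1) of_nat_div_eq_iff[of D "n * N" e m] D pos N' unfolding hgt e by (simp add: mult_ac)
  have \<eta>: "\<omega> ^ (N * e * k) = 1 \<longleftrightarrow> n dvd k" for k
    unfolding \<omega> by (rule dvd_mult_transfer[OF pos(2) D meq hB(2)])
  have \<zeta>: "\<omega> ^ (Q * k) = 1 \<longleftrightarrow> M dvd k" for k
    unfolding \<omega> by (rule dvd_mult_transfer[OF pos(4) D QM qB(2)])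
  have \<phi>_rot: "rot \<theta> (\<phi> g) = \<phi> (rot \<theta> g)" if "\<theta> ^ D = 1" "fps_nth g 0 = 0" for \<theta> g
  proof -
    have "fps_nth (fps_const \<theta> * fps_X) 0 = 0" by simp
    from subst_snd_compose[OF this that(2), of "ramify D f"] show ?thesis
      by (simp add: \<phi>_def rot_ramify[OF that(1) D])
  qed
  have lamN: "rot (\<omega> ^ N) lam = lam"
    unfolding lam_def using rot_to_root_period[OF D N'(1) _ \<sigma>N] \<omega>[of D] by simp
  \<comment> \<open>Since \<open>\<omega> ^ N\<close> fixes the stem, the conjugate of a test series
    stays in \<open>B\<close>. The leading coefficient of \<open>f\<close> on it is read off from
    \<open>F\<close> and also by conjugating the value on the original.\<close>
  have equiv: "poly F (\<omega> ^ (N * e) * x) = \<omega> ^ (N * Q) * poly F x" for x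
  proof -
    define g where "g = to_root D (tr x)"
    have g: "fps_nth g 0 = 0" "agree e g lam" "fps_nth g e = x"
      using tr_0 tr_agree tr_nth[of x e] by (simp_all add: g_def)
    have "agree e (rot (\<omega> ^ N) g) (rot (\<omega> ^ N) lam)"
      using g(2) root_nz(1)[OF \<omega>D] by (simp add: agree_rot_iff)
    then have "lead (\<phi> (rot (\<omega> ^ N) g)) Q (poly F (fps_nth (rot (\<omega> ^ N) g) e))"
      unfolding lamN by (intro lead) (simp_all add: rot_nth g)
    moreover have "lead (\<phi> (rot (\<omega> ^ N) g)) Q ((\<omega> ^ N) ^ Q * poly F x)"
      using lead_rot[OF lead[OF g(1,2)], of "\<omega> ^ N"] unfolding \<phi>_rot[OF \<omega>D g(1)] g(3) .
    ultimately show ?thesis by (simp add: lead_def rot_nth g(3) power_mult)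
  qed

  \<comment> \<open>Leaving the tree, expressed in the variable \<open>s\<close>\<close>
  define P where "P = (\<lambda>\<theta> g. agree e g (rot \<theta> lam) \<and> (\<forall>i\<in>{1..p}. \<not> agree (Suc e) g (a i)))"
  define \<Gamma> where "\<Gamma> = image_mset c (mset_set {1..p-1})"
  have \<Gamma>_0: "fps_nth g 0 = 0" if "g \<in># \<Gamma>" for g
    using that \<gamma>(3) by (auto simp: \<Gamma>_def c_def)
  have \<Gamma>_rot: "image_mset (rot \<theta>) \<Gamma> = \<Gamma>" if "\<theta> ^ D = 1" for \<theta>
    unfolding \<Gamma>_def c_def
    by (rule conjugate_roots[OF that D _ U0' polar_factorization(2)]) simp
  have a_rot: "rot \<theta> ` a ` {1..p} = a ` {1..p}" if "\<theta> ^ D = 1" for \<theta>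
    using arg_cong[OF conjugate_roots[OF that D _ U0 factorization(2)], of set_mset]
    by (simp add: a_def image_image)
  \<comment> \<open>Conjugation permutes the roots of \<open>f\<close>, so the condition excluding
    closer contact is unchanged and only the stem rotates.\<close>
  have P_rot: "P (\<theta> * \<theta>') (rot \<theta> g) \<longleftrightarrow> P \<theta>' g" if "\<theta> ^ D = 1" for \<theta> \<theta>' g
  proof -
    note nz = root_nz(1)[OF that]
    have "(\<exists>i\<in>{1..p}. agree (Suc e) (rot \<theta> g) (a i)) \<longleftrightarrow>
        (\<exists>b\<in>rot \<theta> ` a ` {1..p}. agree (Suc e) (rot \<theta> g) b)"
      unfolding a_rot[OF that] by blast
    also have "\<dots> \<longleftrightarrow> (\<exists>i\<in>{1..p}. agree (Suc e) g (a i))"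
      using nz by (simp add: agree_rot_iff)
    finally show ?thesis
      using agree_rot_iff[OF nz, of e g "rot \<theta>' lam"] unfolding P_def rot_rot by blast
  qed
  \<comment> \<open>For \<open>g\<close> in the ball, a root of \<open>f\<close> agrees with
    \<open>g\<close> through order \<open>e\<close> iff it lies in the ball with the same
    coefficient at \<open>e\<close>; such coefficients are the roots of \<open>F\<close>.\<close>
  have P1: "P 1 g \<longleftrightarrow> agree e g lam \<and> poly F (fps_nth g e) \<noteq> 0" if "fps_nth g 0 = 0" for g
  proof -
    have "agree (Suc e) g (a i) \<longleftrightarrow> agree e (a i) lam \<and> fps_nth (a i) e = fps_nth g e"
      if "agree e g lam" for i
      using that by (auto simp: agree_def less_Suc_eq)
    then show ?thesis by (auto simp: P_def Fp p1_root)
  qed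

  \<comment> \<open>The orbit of the ball\<close>
  define Bk where "Bk = (\<lambda>k. pseudo_ball (conj_series D (\<omega> ^ k) (\<alpha> i0)) h)"
  have conj: "conj_series D (\<omega> ^ k) (\<alpha> i) \<in> puiseux_series"
      "root_support D (conj_series D (\<omega> ^ k) (\<alpha> i))"
      "to_root D (conj_series D (\<omega> ^ k) (\<alpha> i)) = rot (\<omega> ^ k) (a i)" if "i \<in> {1..p}" for i k
    using conj_series_root_series[OF D \<alpha>(3)[OF that] root_nz(2)[OF \<omega>D]]
      root_series_puiseux[OF D] root_series_support[OF D] to_root_conj_series[OF D]
    by (auto simp: a_def)
  have below: "(\<forall>q<h. \<beta> q = conj_series D (\<omega> ^ k) (\<alpha> i0) q) \<longleftrightarrow>
      agree e (to_root D \<beta>) (rot (\<omega> ^ k) lam)" if "root_support D \<beta>" for \<beta> k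
  proof -
    have "agree e (rot (\<omega> ^ k) lam) (rot (\<omega> ^ k) (a i0))"
      using root_nz(1)[OF \<omega>D] a_lam(1) by (simp add: agree_rot_iff agree_sym)
    then show ?thesis
      using agree_to_root_iff[OF D that conj(2)[OF i01(1)], of e k] unfolding conj(3)[OF i01(1)] e
      by (auto simp: agree_def)
  qed
  have Bk_mem: "\<beta> \<in> Bk k \<longleftrightarrow> agree e (to_root D \<beta>) (rot (\<omega> ^ k) lam)"
    if "\<beta> \<in> puiseux_series" "root_support D \<beta>" for \<beta> k
    unfolding Bk_def mem_pseudo_ball[OF conj(1)[OF i01(1)]] below[OF that(2)] using that(1) by simp
  have lam_period: "rot (\<omega> ^ (k mod N)) lam = rot (\<omega> ^ k) lam" for k
  proof -
    have "rot ((\<omega> ^ N) ^ l) lam = lam" for l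
    proof (induction l)
      case (Suc l)
      have "rot ((\<omega> ^ N) ^ Suc l) lam = rot (\<omega> ^ N) (rot ((\<omega> ^ N) ^ l) lam)" by (simp add: rot_rot)
      then show ?case by (simp only: Suc lamN)
    qed simp
    then have "rot (\<omega> ^ (k mod N)) lam = rot (\<omega> ^ (k mod N)) (rot ((\<omega> ^ N) ^ (k div N)) lam)" by simp
    also have "\<dots> = rot (\<omega> ^ (k mod N + N * (k div N))) lam" by (simp only: rot_rot power_add power_mult)
    finally show ?thesis by (simp only: mod_mult_div_eq)
  qed
  \<comment> \<open>\<open>ball_orbit\<close> admits every root of \<open>f\<close> in
    \<open>B\<close> as a centre; below the height all of them agree with
    \<open>\<alpha> i0\<close>.\<close>
  have Bk_eq: "pseudo_ball (conj_series D (\<omega> ^ k) (\<alpha> i)) h = Bk (k mod N)"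
    if "i \<in> {1..p}" "\<alpha> i \<in> B" for i k
  proof -
    have "\<forall>q<h. \<alpha> i q = \<alpha> i0 q"
      using that(2) \<alpha>(1)[OF i01(1)] by (simp add: Bdef mem_pseudo_ball)
    then have "agree e (a i) (a i0)"
      using agree_to_root_iff[OF D \<alpha>(2)[OF that(1)] \<alpha>(2)[OF i01(1)], of e] by (simp add: a_def e)
    then have "agree e (a i) lam" using a_lam(1) by (rule agree_trans)
    then have "agree e (rot (\<omega> ^ k) (a i)) (rot (\<omega> ^ (k mod N)) lam)"
      using root_nz(1)[OF \<omega>D, of k] by (simp add: lam_period agree_rot_iff)
    then have "\<forall>q<h. conj_series D (\<omega> ^ k) (\<alpha> i) q = conj_series D (\<omega> ^ (k mod N)) (\<alpha> i0) q"
      unfolding below[OF conj(2)[OF that(1)]] conj(3)[OF that(1)] .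
    then show ?thesis
      unfolding Bk_def by (rule pseudo_ball_cong[OF conj(1)[OF that(1)] conj(1)[OF i01(1)]])
  qed
  have orbit: "ball_orbit f D B = Bk ` {..<N}"
  proof
    show "ball_orbit f D B \<subseteq> Bk ` {..<N}"
    proof
      fix B' assume "B' \<in> ball_orbit f D B"
      then obtain \<theta> i where "\<theta> ^ D = 1" "i \<in> {1..p}" "\<alpha> i \<in> B"
        and B': "B' = pseudo_ball (conj_series D \<theta> (\<alpha> i)) h"
        unfolding ball_orbit_def hgt Zf by blast
      moreover from this(1) obtain k where "\<theta> = \<omega> ^ k" using \<omega>_all by blast
      ultimately have "B' = Bk (k mod N)" using Bk_eq by simp
      then show "B' \<in> Bk ` {..<N}" using N'(1) by simp
    qed
    show "Bk ` {..<N} \<subseteq> ball_orbit f D B"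
      unfolding ball_orbit_def hgt Zf Bk_def using \<omega>D i01(1) \<open>\<alpha> i0 \<in> B\<close> by blast
  qed
  have inj: "inj_on Bk {..<N}"
  proof (rule linorder_inj_onI)
    fix k l assume kl: "k < l" "k \<in> {..<N}" "l \<in> {..<N}"
    show "Bk k \<noteq> Bk l"
    proof
      assume "Bk k = Bk l"
      moreover have "conj_series D (\<omega> ^ k) (\<alpha> i0) \<in> Bk k"
        unfolding Bk_def by (simp add: mem_pseudo_ball conj(1)[OF i01(1)])
      ultimately have "agree e (rot (\<omega> ^ k) (a i0)) (rot (\<omega> ^ l) lam)"
        using Bk_mem[OF conj(1,2)[OF i01(1)]] conj(3)[OF i01(1)] by simp
      moreover have "rot (\<omega> ^ l) lam = rot (\<omega> ^ k) (rot (\<omega> ^ (l - k)) lam)"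
        using kl(1) by (simp add: rot_rot flip: power_add)
      ultimately have "agree e (a i0) (rot (\<omega> ^ (l - k)) lam)"
        using root_nz(1)[OF \<omega>D] by (simp add: agree_rot_iff)
      \<comment> \<open>\<open>lam\<close> vanishes from \<open>e\<close> on, and below
        \<open>e\<close> it equals \<open>a i0\<close>, so agreement below \<open>e\<close> is
        already equality.\<close>
      then have "rot (\<omega> ^ (l - k)) lam = lam"
        by (auto simp: fps_eq_iff agree_def lam_nth rot_nth)
      moreover have "rot (\<omega> ^ (l - k)) lam \<noteq> lam" unfolding lam_def
      proof (rule rot_to_root_minimal[OF D \<omega>, of \<sigma> h])
        show "root_support D \<sigma>" using tr(3) stem by simp
        show "\<sigma> q = 0" if "q > h" for q using that by (simp add: stem tr_def truncation_def)
        show "0 < l - k" "l - k < puiseux_index \<sigma>" using kl N by (auto simp: \<sigma>_def)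
      qed
      ultimately show False by simp
    qed
  qed auto

  \<comment> \<open>Polar roots leaving at a conjugate ball\<close>
  have leaves: "leaves_tree_at \<alpha> p (\<gamma> j) (Bk k) \<longleftrightarrow> P (\<omega> ^ k) (c j)" if j: "j \<in> {1..p-1}" for j k
  proof -
    have hk: "height (Bk k) = h" unfolding Bk_def by (rule height_pseudo_ball[OF conj(1)[OF i01(1)] h])
    have mem: "\<gamma> j \<in> Bk k \<longleftrightarrow> agree e (c j) (rot (\<omega> ^ k) lam)"
      unfolding c_def by (rule Bk_mem[OF \<gamma>(1,2)[OF j]])
    have le: "contact (\<alpha> i) (\<gamma> j) \<le> Fin h \<longleftrightarrow> \<not> agree (Suc e) (c j) (a i)" if "i \<in> {1..p}" for i
      unfolding contact_le_iff[OF \<alpha>(1)[OF that] \<gamma>(1)[OF j]] a_def c_def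
        agree_Suc_to_root_iff[OF D \<gamma>(2)[OF j] \<alpha>(2)[OF that]] e by (auto simp: eq_commute)
    \<comment> \<open>The conjugate of \<open>\<alpha> i0\<close> is a root of \<open>f\<close> in
      this ball, so the maximal contact is at least \<open>h\<close>; it equals \<open>h\<close> iff
      no contact exceeds \<open>h\<close>.\<close>
    have ex: "\<exists>i\<in>{1..p}. contact (\<alpha> i) (\<gamma> j) \<ge> Fin h" if "agree e (c j) (rot (\<omega> ^ k) lam)"
    proof -
      obtain i where i: "i \<in> {1..p}" "rot (\<omega> ^ k) (a i0) = a i" using a_rot[OF \<omega>D, of k] i01(1) by blast
      have "agree e (rot (\<omega> ^ k) (a i0)) (rot (\<omega> ^ k) lam)"
        using root_nz(1)[OF \<omega>D] a_lam(1) by (simp add: agree_rot_iff)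
      then have "agree e (a i) (c j)" using that i(2) by (simp add: agree_def)
      then have "contact (\<alpha> i) (\<gamma> j) \<ge> Fin h"
        unfolding contact_ge_iff[OF \<alpha>(1)[OF i(1)] \<gamma>(1)[OF j]] a_def c_def
          agree_to_root_iff[OF D \<alpha>(2)[OF i(1)] \<gamma>(2)[OF j]] e .
      then show ?thesis using i(1) by blast
    qed
    have "Fin h = Max ((\<lambda>i. contact (\<alpha> i) (\<gamma> j)) ` {1..p}) \<longleftrightarrow>
        (\<forall>i\<in>{1..p}. contact (\<alpha> i) (\<gamma> j) \<le> Fin h)" if "agree e (c j) (rot (\<omega> ^ k) lam)"
    proof
      assume "\<forall>i\<in>{1..p}. contact (\<alpha> i) (\<gamma> j) \<le> Fin h"
      moreover from this ex[OF that] obtain i where "i \<in> {1..p}" "contact (\<alpha> i) (\<gamma> j) = Fin h"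
        by (meson order_antisym)
      ultimately show "Fin h = Max ((\<lambda>i. contact (\<alpha> i) (\<gamma> j)) ` {1..p})"
        by (intro Max_eqI[symmetric]) force+
    qed simp
    then show ?thesis unfolding leaves_tree_at_def hk mem P_def using le by blast
  qed

  \<comment> \<open>Descent of the orbit product to \<open>u\<close> and \<open>v\<close>\<close>
  define dsc where "dsc = (\<lambda>k. \<Prod>g\<in>#filter_mset (P (\<omega> ^ k)) \<Gamma>. fps_X - fps_const (\<phi> g))"
  have disc: "disc_ball f \<alpha> \<gamma> p D (Bk k) = dsc k" for k
  proof -
    have "disc_ball f \<alpha> \<gamma> p D (Bk k) =
        (\<Prod>j\<in>{j\<in>{1..p-1}. P (\<omega> ^ k) (c j)}. fps_X - fps_const (\<phi> (c j)))"
      unfolding disc_ball_def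
    proof (rule prod.cong)
      show "{j\<in>{1..p-1}. leaves_tree_at \<alpha> p (\<gamma> j) (Bk k)} = {j\<in>{1..p-1}. P (\<omega> ^ k) (c j)}"
        using leaves by blast
      fix j assume "j \<in> {j\<in>{1..p-1}. P (\<omega> ^ k) (c j)}"
      then have "j \<in> {1..p-1}" by simp
      then show "fps_X - fps_const (to_root D (subst_puiseux f (\<gamma> j))) = fps_X - fps_const (\<phi> (c j))"
        using to_root_subst_puiseux[OF D \<gamma>] by (simp add: \<phi>_def c_def)
    qed
    then show ?thesis
      by (simp add: dsc_def \<Gamma>_def filter_mset_image_mset prod_unfold_prod_mset
          image_mset.compositionality comp_def)
  qed
  have dsc_rot: "comp_fst (fps_const (\<omega> ^ l) * fps_X) (dsc k) = dsc (l + k)" for k l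
    unfolding dsc_def \<phi>_def
    by (rule comp_fst_linear_product[OF D \<omega>D \<Gamma>_rot[OF \<omega>D] \<Gamma>_0])
      (simp_all add: power_add P_rot[OF \<omega>D])
  \<comment> \<open>\<open>lam\<close> is fixed by \<open>\<omega> ^ N\<close>, so conjugation by
    \<omega> permutes the factors \<open>dsc k\<close> with \<open>k < N\<close> cyclically and
    their product is invariant.\<close>
  have dscN: "dsc N = dsc 0" by (simp add: dsc_def P_def lamN)
  define W where "W = (\<Prod>k<N. dsc k)"
  have X0: "fps_nth (fps_const \<theta> * fps_X) 0 = 0" for \<theta> :: complex by simp
  have "comp_fst (fps_const \<omega> * fps_X) W = (\<Prod>k<N. dsc (Suc k))"
    unfolding W_def comp_fst_prod[OF X0] using dsc_rot[of 1] by simp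
  also have "\<dots> = W"
  proof -
    obtain l where l: "N = Suc l" using N'(1) gr0_implies_Suc by blast
    have "(\<Prod>k<N. dsc (Suc k)) = (\<Prod>k<l. dsc (Suc k)) * dsc 0"
      using dscN by (simp add: l)
    also have "\<dots> = W" unfolding W_def l by (simp only: prod.lessThan_Suc_shift mult.commute)
    finally show ?thesis .
  qed
  finally obtain G where G: "ramify D G = W" using ramify_exists[OF D \<omega>] by blast
  have "(\<Prod>B'\<in>ball_orbit f D B. disc_ball f \<alpha> \<gamma> p D B') = W"
    unfolding orbit W_def by (simp add: prod.reindex[OF inj] disc)
  then have orbitG: "disc_orbit f \<alpha> \<gamma> p D B = G"
    unfolding disc_orbit_def using G ramify_inject[OF D] by (intro the_equality) auto

  \<comment> \<open>Leading coefficients of the orbit product\<close>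
  define \<Gamma>0 where "\<Gamma>0 = filter_mset (P 1) \<Gamma>"
  \<comment> \<open>Only the polar roots leaving at \<open>B\<close> itself are used; the other
    balls contribute conjugates of their values, as \<open>dsc k\<close> is conjugate to
    \<open>dsc 0\<close>.\<close>
  define A where "A = (\<Sum>k<N. image_mset (\<lambda>g. rot (\<omega> ^ k) (\<phi> g)) \<Gamma>0)"
  have dsc_eq: "dsc k = (\<Prod>g\<in>#\<Gamma>0. fps_X - fps_const (rot (\<omega> ^ k) (\<phi> g)))" for k
  proof -
    have "dsc k = comp_fst (fps_const (\<omega> ^ k) * fps_X) (dsc 0)" using dsc_rot[of k 0] by simp
    then show ?thesis
      by (simp add: dsc_def \<Gamma>0_def comp_fst_prod_mset[OF X0] comp_fst_diff)
  qed
  have WA: "W = (\<Prod>b\<in>#A. fps_X - fps_const b)"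
    unfolding W_def A_def prod_mset_image_sum dsc_eq
    by (simp add: image_mset.compositionality comp_def)
  have \<Gamma>0: "fps_nth g 0 = 0" "agree e g lam" "poly F (fps_nth g e) \<noteq> 0" if "g \<in># \<Gamma>0" for g
    using that \<Gamma>_0 P1 by (auto simp: \<Gamma>0_def)
  have lead_rot_\<phi>: "lead (rot (\<omega> ^ k) (\<phi> g)) Q (\<omega> ^ (k * Q) * poly F (fps_nth g e))" if "g \<in># \<Gamma>0" for g k
    using lead_rot[OF lead[OF \<Gamma>0(1,2)[OF that]], of "\<omega> ^ k"] by (simp add: power_mult)
  \<comment> \<open>The polar roots in \<open>B\<close> have as coefficients at \<open>e\<close> all
    roots of \<open>p2\<close>, the derivative of \<open>F\<close>; by \<open>P1\<close> those
    leaving the tree are the ones where \<open>F\<close> does not vanish.\<close>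
  have "image_mset (\<lambda>g. fps_nth g e) \<Gamma>0 =
      image_mset (\<lambda>j. fps_nth (c j) e) (mset_set {j\<in>{1..p-1}. P 1 (c j)})"
    by (simp add: \<Gamma>0_def \<Gamma>_def filter_mset_image_mset image_mset.compositionality comp_def)
  also have "{j\<in>{1..p-1}. P 1 (c j)} =
      {j\<in>{j\<in>{1..p-1}. agree e (c j) lam}. poly F (fps_nth (c j) e) \<noteq> 0}"
    using P1[of "c _"] \<gamma>(3) by (auto simp: c_def)
  also have "image_mset (\<lambda>j. fps_nth (c j) e) (mset_set \<dots>) = filter_mset (\<lambda>x. poly F x \<noteq> 0)
      (image_mset (\<lambda>j. fps_nth (c j) e) (mset_set {j\<in>{1..p-1}. agree e (c j) lam}))"
    by (simp add: filter_mset_image_mset)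
  also have "image_mset (\<lambda>j. fps_nth (c j) e) (mset_set {j\<in>{1..p-1}. agree e (c j) lam}) = proots p2"
  proof -
    have "proots p2 = (\<Sum>j\<in>{j\<in>{1..p-1}. agree e (c j) lam}. proots [:- fps_nth (c j) e, 1:])"
      unfolding p2 using K' by (simp add: proots_prod)
    then show ?thesis by (simp add: sum_unfold_sum_mset)
  qed
  finally have S: "image_mset (\<lambda>g. fps_nth g e) \<Gamma>0 =
      filter_mset (\<lambda>x. poly F x \<noteq> 0) (proots (pderiv F))"
    by (simp add: p12 Fp)
  \<comment> \<open>The roots \<open>a i0\<close> and \<open>a i1\<close> give \<open>F\<close> two
    distinct zeros, hence a critical point off its zeros. This makes the orbit product nontrivial,
    so that its diagram has a compact edge.\<close>
  have "\<Gamma>0 \<noteq> {#}"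
  proof
    assume "\<Gamma>0 = {#}"
    moreover have "poly F (fps_nth (a i0) e) = 0" "poly F (fps_nth (a i1) e) = 0"
      unfolding Fp p1_root using i01 a_lam by blast+
    ultimately show False
      using critical_point_off_roots[OF _ _ a_sep F_nz] S by (metis image_mset_empty)
  qed
  then have A_ne: "A \<noteq> {#}" using N'(1) by (cases N) (auto simp: A_def)
  have A_lead: "lead b Q (fps_nth b Q) \<and> fps_nth b Q \<noteq> 0" if bA: "b \<in># A" for b
  proof -
    obtain k g where b: "b = rot (\<omega> ^ k) (\<phi> g)" "g \<in># \<Gamma>0"
      using bA by (auto simp: A_def set_mset_sum)
    have "\<omega> ^ (k * Q) * poly F (fps_nth g e) \<noteq> 0"
      using \<Gamma>0(3)[OF b(2)] root_nz(1)[OF \<omega>D, of "k * Q"] by simp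
    then show ?thesis using lead_rot_\<phi>[OF b(2), of k] by (auto simp: lead_def b(1))
  qed

  \<comment> \<open>Evaluation of the product of leading forms\<close>
  define J' where "J' = {j\<in>{1..r}. poly H (t j) \<noteq> 0}"
  have JJ: "J = J'" using w(2) by (auto simp: J J'_def)
  define R where "R = (if poly H 0 \<noteq> 0
      then quasi_factor M L (poly H 0) ^ ((n - 1) * N div M) *
        (\<Prod>j\<in>J'. quasi_factor M L (poly H (t j)) ^ (n * N div M))
      else (\<Prod>j\<in>J'. quasi_factor M L (poly H (t j)) ^ (n * N div M)))"
  have "(\<Prod>b\<in>#A. hfactor Q (fps_nth b Q)) =
      (\<Prod>k<N. \<Prod>g\<in>#\<Gamma>0. hfactor Q (\<omega> ^ (k * Q) * poly F (fps_nth g e)))"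
    unfolding A_def prod_mset_image_sum
  proof (rule prod.cong[OF refl])
    fix k
    have "(\<Prod>b\<in>#image_mset (\<lambda>g. rot (\<omega> ^ k) (\<phi> g)) \<Gamma>0. hfactor Q (fps_nth b Q)) =
        (\<Prod>g\<in>#\<Gamma>0. hfactor Q (fps_nth (rot (\<omega> ^ k) (\<phi> g)) Q))"
      by (simp add: image_mset.compositionality comp_def)
    also have "\<dots> = (\<Prod>g\<in>#\<Gamma>0. hfactor Q (\<omega> ^ (k * Q) * poly F (fps_nth g e)))"
      using lead_rot_\<phi> by (intro arg_cong[where f = prod_mset] image_mset_cong) (simp add: lead_def)
    finally show "(\<Prod>b\<in>#image_mset (\<lambda>g. rot (\<omega> ^ k) (\<phi> g)) \<Gamma>0. hfactor Q (fps_nth b Q)) =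
        (\<Prod>g\<in>#\<Gamma>0. hfactor Q (\<omega> ^ (k * Q) * poly F (fps_nth g e)))" .
  qed
  also have "\<dots> = (\<Prod>k<N. \<Prod>x\<in>#image_mset (\<lambda>g. fps_nth g e) \<Gamma>0. hfactor Q (\<omega> ^ (k * Q) * poly F x))"
    by (simp add: image_mset.compositionality comp_def)
  also have "\<dots> = ramify D R"
    unfolding S R_def J'_def
    by (rule orbit_hfactor_product[OF D pos(2,4) QM \<zeta> \<eta> equiv F' HB HB' MnN MN])
  finally have "newton_initial G = R"
    using newton_initial_ramified[OF D Q A_ne A_lead G[unfolded WA]] by simp
  moreover have "R = (if w 0 \<noteq> 0
            then quasi_factor M L (w 0) ^ ((n - 1) * N div M) *
                 (\<Prod>j\<in>J. quasi_factor M L (w j) ^ (n * N div M))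
            else (\<Prod>j\<in>J. quasi_factor M L (w j) ^ (n * N div M)))"
    using w by (simp add: R_def JJ J'_def)
  moreover have "M dvd (n - 1) * N" if "w 0 \<noteq> 0"
  proof -
    have "poly F 0 ^ M = poly H 0"
      using arg_cong[OF HB, of "\<lambda>p. poly p 0"] pos(2) by (simp add: poly_pcompose poly_monom power_0_left)
    then have "poly F 0 \<noteq> 0" using that w(1) pos(4) by (metis power_eq_0_iff)
    then show ?thesis using MN by simp
  qed
  ultimately show ?thesis using MnN orbitG by simp
qed

end
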